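(* Let $\Gamma=([n],A,B,K_A,K_B,r,p)$ be a zero-sum stochastic game with finite state space $[n]=\{1,\dots,n\}$ such that, for every state $i\in[n]$: (i) the action sets $A_i$ and $B_i$ are nonempty and compact; (ii) the payoff function $r(i,\cdot,\cdot)$ is bounded from below or from above; (iii) for every $(a,b)\in A_i\times B_i$, the functions $r(i,\cdot,b)$ and $p(j\mid i,\cdot,b)$, $j\in[n]$, are upper semicontinuous, and the functions $r(i,a,\cdot)$ and $p(j\mid i,a,\cdot)$, $j\in[n]$, are lower semicontinuous. Then $\Gamma$ is ergodic if and only if the players do not have disjoint dominions, i.e., there do not exist a dominion $D$ of player Max and a dominion $D'$ of player Min with $D\cap D'=\emptyset$.
   Context: A (zero-sum) stochastic game is a tuple $\Gamma=([n],A,B,K_A,K_B,r,p)$ where: $[n]=\{1,\dots,n\}$ is the state space; $A,B$ are Borel spaces (Borel subsets of Polish spaces), the action spaces of players Max and Min; $K_A\subset[n]\times A$ and $K_B\subset[n]\times B$ are Borel, and $A_i=\{a\mid(i,a)\in K_A\}$, $B_i=\{b\mid(i,b)\in K_B\}$ are the actions available in state $i$; $K=\{(i,a,b)\mid i\in[n],a\in A_i,b\in B_i\}$; $r:K\to\mathbb{R}$ is a Borel measurable payoff function; $p:K\to\Delta([n])$ is a Borel measurable transition function, where $\Delta(X)$ denotes the set of Borel probability measures on $X$ and $p(\ell\mid i,a,b)$ is the probability of state $\ell$. For Borel measurable $f:K\to\mathbb{R}$, put $f(i,\mu,\nu)=\int_{A_i}\int_{B_i}f(i,a,b)\,d\mu(a)\,d\nu(b)$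 for $\mu\in\Delta(A_i)$, $\nu\in\Delta(B_i)$. Play: at each stage, in current state $i$, the players simultaneously and independently choose actions $a\in A_i$, $b\in B_i$; the next state is drawn from $p(\cdot\mid i,a,b)$, and the new state and the actions are announced to both. With $H_k=K^{k-1}\times[n]$ ($k\geq1$) the set of histories of length $k$, a strategy of Max is a Borel measurable map $\sigma:\bigcup_{k\geq1}H_k\to\bigcup_i\Delta(A_i)$ with $\sigma(h_k)\in\Delta(A_{i_k})$ for every history $h_k=(i_1,a_1,b_1,\dots,i_k)$; strategies of Min are defined likewise with $B$. An initial state and a pair of strategies induce a probability measure on infinite histories. A dominion of player Max (resp. Min) is a nonempty subset $D\subset[n]$ for which Max (resp. Min) has a strategy such that from any initial state in $D$ the state remains almost surely in $D$ at all stages, whatever strategy the other player chooses. The Shapley operator of $\Gamma$ is $T:\mathbb{R}^n\to\mathbb{R}^n$ with $$T_i(x)=\sup_{\mu\in\Delta(A_i)}\inf_{\nu\in\Delta(B_i)}\Big\{r(i,\mu,\nu)+\sum_{\ell\in[n]}x_\ell\,p(\ell\mid i,\mu,\nu)\Big\}=\inf_{\nu\in\Delta(B_i)}\sup_{\mu\in\Delta(A_i)}\Big\{r(i,\mu,\nu)+\sum_{\ell\in[n]}x_\ell\,p(\ell\mid i,\mu,\nu)\Big\}.$$ Standing convention: the Shapley operator is well defined (sup-inf and inf-sup equal and finite), which is the case under hypotheses (i)–(iii). Let $e=(1,\dots,1)^\top$. The ergodic equation for a map $F:\mathbb{R}^n\to\mathbb{R}^n$ is $F(u)=\lambda e+u$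 with unknowns $(\lambda,u)\in\mathbb{R}\times\mathbb{R}^n$; it is solvable if such a pair exists. The game $\Gamma$ is ergodic if for every $g\in\mathbb{R}^n$ the ergodic equation is solvable for $g+T$. *)

theory Defs
  imports "HOL-Probability.Probability"
begin

text \<open>
  The state space \<open>[n]\<close> is the universe of a type \<^typ>\<open>'n\<close> of class \<open>finite\<close>, with its discrete
  \<open>\<sigma>\<close>-algebra. The action spaces are Borel subsets of two types of class \<open>polish_space\<close>.
  The payoff and transition functions are only meaningful on \<open>K\<close>; their values outside \<open>K\<close> are
  never used.
\<close>

record ('n, 'a, 'b) stochastic_game =
  max_acts :: "'a set"
  min_acts :: "'b set"
  max_graph :: "('n \<times> 'a) set"
  min_graph :: "('n \<times> 'b) set"
  payoff :: "'n \<times> 'a \<times> 'b \<Rightarrow> real"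
  trans_law :: "'n \<times> 'a \<times> 'b \<Rightarrow> 'n measure"

definition max_avail :: "('n, 'a, 'b) stochastic_game \<Rightarrow> 'n \<Rightarrow> 'a set" where
  "max_avail \<Gamma> i = {a. (i, a) \<in> max_graph \<Gamma>}"

definition min_avail :: "('n, 'a, 'b) stochastic_game \<Rightarrow> 'n \<Rightarrow> 'b set" where
  "min_avail \<Gamma> i = {b. (i, b) \<in> min_graph \<Gamma>}"

definition feasible :: "('n, 'a, 'b) stochastic_game \<Rightarrow> ('n \<times> 'a \<times> 'b) set" where
  "feasible \<Gamma> = {(i, a, b). a \<in> max_avail \<Gamma> i \<and> b \<in> min_avail \<Gamma> i}"

definition K_space ::
  "('n, 'a::topological_space, 'b::topological_space) stochastic_game \<Rightarrow> ('n \<times> 'a \<times> 'b) measure" where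
  "K_space \<Gamma> = restrict_space (count_space UNIV \<Otimes>\<^sub>M (borel \<Otimes>\<^sub>M borel)) (feasible \<Gamma>)"

text \<open>
  On a separable metrizable space, the \<open>\<sigma>\<close>-algebra of \<^const>\<open>prob_algebra\<close> (generated by the
  evaluations at measurable sets) is the Borel \<open>\<sigma>\<close>-algebra of the topology of weak convergence.
\<close>

definition is_stochastic_game ::
  "('n::finite, 'a::polish_space, 'b::polish_space) stochastic_game \<Rightarrow> bool" where
  "is_stochastic_game \<Gamma> \<longleftrightarrow>
     max_acts \<Gamma> \<in> sets borel \<and>
     min_acts \<Gamma> \<in> sets borel \<and>
     max_graph \<Gamma> \<subseteq> UNIV \<times> max_acts \<Gamma> \<and>
     max_graph \<Gamma> \<in> sets (count_space UNIV \<Otimes>\<^sub>M borel) \<and>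
     min_graph \<Gamma> \<subseteq> UNIV \<times> min_acts \<Gamma> \<and>
     min_graph \<Gamma> \<in> sets (count_space UNIV \<Otimes>\<^sub>M borel) \<and>
     payoff \<Gamma> \<in> borel_measurable (K_space \<Gamma>) \<and>
     trans_law \<Gamma> \<in> K_space \<Gamma> \<rightarrow>\<^sub>M prob_algebra (count_space UNIV)"

definition trans_prob :: "('n, 'a, 'b) stochastic_game \<Rightarrow> 'n \<Rightarrow> 'n \<times> 'a \<times> 'b \<Rightarrow> real" where
  "trans_prob \<Gamma> l k = measure (trans_law \<Gamma> k) {l}"

definition borel_probs :: "'x::topological_space set \<Rightarrow> 'x measure set" where
  "borel_probs X = space (prob_algebra (restrict_space borel X))"

text \<open>
  Integral of a quasi-integrable extended real function. It must be allowed to be infinite, because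
  a payoff that is bounded on one side only need not be integrable.
\<close>

definition quasi_integral :: "'x measure \<Rightarrow> ('x \<Rightarrow> ereal) \<Rightarrow> ereal" where
  "quasi_integral M f =
     enn2ereal (\<integral>\<^sup>+ x. e2ennreal (f x) \<partial>M) - enn2ereal (\<integral>\<^sup>+ x. e2ennreal (- f x) \<partial>M)"

definition mixed_ext ::
  "('n \<times> 'a \<times> 'b \<Rightarrow> real) \<Rightarrow> 'n \<Rightarrow> 'a measure \<Rightarrow> 'b measure \<Rightarrow> ereal" where
  "mixed_ext f i \<mu> \<nu> = quasi_integral \<mu> (\<lambda>a. quasi_integral \<nu> (\<lambda>b. ereal (f (i, a, b))))"

text \<open>
  For compact action sets and one-sided bounded, separately semicontinuous data, the inner sup-inf
  below is finite and equals the inf-sup, so that \<^const>\<open>real_of_ereal\<close> loses nothing.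
\<close>

definition shapley ::
  "('n::finite, 'a::polish_space, 'b::polish_space) stochastic_game \<Rightarrow> real ^ 'n \<Rightarrow> real ^ 'n" where
  "shapley \<Gamma> x = (\<chi> i. real_of_ereal
     (SUP \<mu>\<in>borel_probs (max_avail \<Gamma> i). INF \<nu>\<in>borel_probs (min_avail \<Gamma> i).
        mixed_ext (payoff \<Gamma>) i \<mu> \<nu> + (\<Sum>l\<in>UNIV. ereal (x $ l) * mixed_ext (trans_prob \<Gamma> l) i \<mu> \<nu>)))"

definition ergodic_eq_solvable :: "(real ^ 'n \<Rightarrow> real ^ 'n) \<Rightarrow> bool" where
  "ergodic_eq_solvable F \<longleftrightarrow> (\<exists>(c::real) u. F u = c *\<^sub>R (\<chi> i. 1) + u)"

definition ergodic ::
  "('n::finite, 'a::polish_space, 'b::polish_space) stochastic_game \<Rightarrow> bool" where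
  "ergodic \<Gamma> \<longleftrightarrow> (\<forall>g. ergodic_eq_solvable (\<lambda>x. g + shapley \<Gamma> x))"

text \<open>
  Stages are counted from 0: a history available at stage \<open>m\<close> is a pair \<open>(\<omega>, i)\<close>, where
  \<open>\<omega> \<in> K\<^bsup>m\<^esup>\<close> lists the past states and actions and \<open>i\<close> is the current state. Since there are
  finitely many states, joint measurability in \<open>(\<omega>, i)\<close> is measurability in \<open>\<omega>\<close> for each \<open>i\<close>.
\<close>

type_synonym ('n, 'a, 'b, 'c) strategy = "nat \<Rightarrow> (nat \<Rightarrow> 'n \<times> 'a \<times> 'b) \<times> 'n \<Rightarrow> 'c measure"

definition max_strategy ::
  "('n, 'a::polish_space, 'b::polish_space) stochastic_game \<Rightarrow> ('n, 'a, 'b, 'a) strategy \<Rightarrow> bool" where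
  "max_strategy \<Gamma> \<sigma> \<longleftrightarrow> (\<forall>m i. (\<lambda>\<omega>. \<sigma> m (\<omega>, i)) \<in>
     (\<Pi>\<^sub>M t\<in>{0..<m}. K_space \<Gamma>) \<rightarrow>\<^sub>M prob_algebra (restrict_space borel (max_avail \<Gamma> i)))"

definition min_strategy ::
  "('n, 'a::polish_space, 'b::polish_space) stochastic_game \<Rightarrow> ('n, 'a, 'b, 'b) strategy \<Rightarrow> bool" where
  "min_strategy \<Gamma> \<tau> \<longleftrightarrow> (\<forall>m i. (\<lambda>\<omega>. \<tau> m (\<omega>, i)) \<in>
     (\<Pi>\<^sub>M t\<in>{0..<m}. K_space \<Gamma>) \<rightarrow>\<^sub>M prob_algebra (restrict_space borel (min_avail \<Gamma> i)))"

definition state_law ::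
  "('n, 'a, 'b) stochastic_game \<Rightarrow> 'n \<Rightarrow> nat \<Rightarrow> (nat \<Rightarrow> 'n \<times> 'a \<times> 'b) \<Rightarrow> 'n measure" where
  "state_law \<Gamma> i m \<omega> = (case m of 0 \<Rightarrow> return (count_space UNIV) i | Suc k \<Rightarrow> trans_law \<Gamma> (\<omega> k))"

definition stage_law ::
  "('n, 'a::polish_space, 'b::polish_space) stochastic_game \<Rightarrow> ('n, 'a, 'b, 'a) strategy \<Rightarrow>
   ('n, 'a, 'b, 'b) strategy \<Rightarrow> 'n \<Rightarrow> nat \<Rightarrow> (nat \<Rightarrow> 'n \<times> 'a \<times> 'b) \<Rightarrow> ('n \<times> 'a \<times> 'b) measure" where
  "stage_law \<Gamma> \<sigma> \<tau> i m \<omega> = state_law \<Gamma> i m \<omega> \<bind>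
     (\<lambda>j. distr (\<sigma> m (\<omega>, j) \<Otimes>\<^sub>M \<tau> m (\<omega>, j)) (K_space \<Gamma>) (\<lambda>(a, b). (j, a, b)))"

text \<open>
  The law of the infinite history \<open>(i\<^sub>0, a\<^sub>0, b\<^sub>0, i\<^sub>1, a\<^sub>1, b\<^sub>1, \<dots>)\<close> given by the theorem of
  Ionescu-Tulcea applied to the conditional laws \<^const>\<open>stage_law\<close>.
\<close>

definition play_law ::
  "('n, 'a::polish_space, 'b::polish_space) stochastic_game \<Rightarrow> ('n, 'a, 'b, 'a) strategy \<Rightarrow>
   ('n, 'a, 'b, 'b) strategy \<Rightarrow> 'n \<Rightarrow> (nat \<Rightarrow> 'n \<times> 'a \<times> 'b) measure" where
  "play_law \<Gamma> \<sigma> \<tau> i = projective_family.lim UNIV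
     (Ionescu_Tulcea.CI (stage_law \<Gamma> \<sigma> \<tau> i) (\<lambda>_. K_space \<Gamma>)) (\<lambda>_. K_space \<Gamma>)"

lemma Ionescu_Tulcea_stage_law:
  fixes \<Gamma> :: "('n::finite, 'a::polish_space, 'b::polish_space) stochastic_game"
  assumes \<Gamma>: "is_stochastic_game \<Gamma>" and \<sigma>: "max_strategy \<Gamma> \<sigma>" and \<tau>: "min_strategy \<Gamma> \<tau>"
  shows "Ionescu_Tulcea (stage_law \<Gamma> \<sigma> \<tau> i) (\<lambda>_. K_space \<Gamma>)"
proof -
  have step: "(\<lambda>\<omega>. distr (\<sigma> m (\<omega>, j) \<Otimes>\<^sub>M \<tau> m (\<omega>, j)) (K_space \<Gamma>) (\<lambda>(a, b). (j, a, b))) \<in>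
      (\<Pi>\<^sub>M t\<in>{0..<m}. K_space \<Gamma>) \<rightarrow>\<^sub>M prob_algebra (K_space \<Gamma>)" for m j
  proof (rule measurable_distr_prob_space2)
    show "(\<lambda>\<omega>. \<sigma> m (\<omega>, j) \<Otimes>\<^sub>M \<tau> m (\<omega>, j)) \<in> (\<Pi>\<^sub>M t\<in>{0..<m}. K_space \<Gamma>) \<rightarrow>\<^sub>M
        prob_algebra (restrict_space borel (max_avail \<Gamma> j) \<Otimes>\<^sub>M restrict_space borel (min_avail \<Gamma> j))"
      using \<sigma> \<tau> unfolding max_strategy_def min_strategy_def by (intro measurable_pair_prob) auto
    have "(\<lambda>p. (j, p)) \<in> (restrict_space borel (max_avail \<Gamma> j) \<Otimes>\<^sub>M restrict_space borel (min_avail \<Gamma> j))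
        \<rightarrow>\<^sub>M count_space UNIV \<Otimes>\<^sub>M (borel \<Otimes>\<^sub>M borel)"
    proof (rule measurable_Pair)
      show "(\<lambda>p. p) \<in> (restrict_space borel (max_avail \<Gamma> j) \<Otimes>\<^sub>M restrict_space borel (min_avail \<Gamma> j))
          \<rightarrow>\<^sub>M (borel \<Otimes>\<^sub>M borel)"
        by (rule measurable_pair)
          (auto simp: comp_def intro!: measurable_compose[OF measurable_fst] measurable_compose[OF measurable_snd] measurable_restrict_space1)
    qed simp
    then have "(\<lambda>p. (j, p)) \<in> (restrict_space borel (max_avail \<Gamma> j) \<Otimes>\<^sub>M restrict_space borel (min_avail \<Gamma> j))
        \<rightarrow>\<^sub>M K_space \<Gamma>"
      unfolding K_space_def
      by (intro measurable_restrict_space2) (auto simp: space_pair_measure space_restrict_space feasible_def)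
    then have "(\<lambda>p. case snd p of (a, b) \<Rightarrow> (j, a, b)) \<in> (\<Pi>\<^sub>M t\<in>{0..<m}. K_space \<Gamma>) \<Otimes>\<^sub>M
        (restrict_space borel (max_avail \<Gamma> j) \<Otimes>\<^sub>M restrict_space borel (min_avail \<Gamma> j)) \<rightarrow>\<^sub>M K_space \<Gamma>"
      by (intro measurable_compose[OF measurable_snd]) simp
    then show "(\<lambda>(\<omega>, (a, b)). (j, a, b)) \<in> (\<Pi>\<^sub>M t\<in>{0..<m}. K_space \<Gamma>) \<Otimes>\<^sub>M
        (restrict_space borel (max_avail \<Gamma> j) \<Otimes>\<^sub>M restrict_space borel (min_avail \<Gamma> j)) \<rightarrow>\<^sub>M K_space \<Gamma>"
      by (simp add: case_prod_beta')
  qed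
  have st: "state_law \<Gamma> i m \<in> (\<Pi>\<^sub>M t\<in>{0..<m}. K_space \<Gamma>) \<rightarrow>\<^sub>M prob_algebra (count_space UNIV)" for m
  proof (cases m)
    case 0
    then show ?thesis
      by (auto simp: state_law_def[abs_def] space_prob_algebra intro!: measurable_const prob_space_return)
  next
    case (Suc k)
    have "(\<lambda>\<omega>. trans_law \<Gamma> (\<omega> k)) \<in> (\<Pi>\<^sub>M t\<in>{0..<Suc k}. K_space \<Gamma>) \<rightarrow>\<^sub>M prob_algebra (count_space UNIV)"
      using \<Gamma> unfolding is_stochastic_game_def
      by (intro measurable_compose[OF measurable_component_singleton]) auto
    then show ?thesis by (simp add: Suc state_law_def[abs_def])
  qed
  have P: "stage_law \<Gamma> \<sigma> \<tau> i m \<in> (\<Pi>\<^sub>M t\<in>{0..<m}. K_space \<Gamma>) \<rightarrow>\<^sub>M prob_algebra (K_space \<Gamma>)" for m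
    unfolding stage_law_def[abs_def]
  proof (rule measurable_bind_prob_space2[OF st])
    define f where "f = (\<lambda>j \<omega>. distr (\<sigma> m (\<omega>, j) \<Otimes>\<^sub>M \<tau> m (\<omega>, j)) (K_space \<Gamma>) (\<lambda>(a, b). (j, a, b)))"
    let ?N = "(\<Pi>\<^sub>M t\<in>{0..<m}. K_space \<Gamma>) \<Otimes>\<^sub>M count_space (UNIV :: 'n set)"
    have f: "(\<lambda>p. f j (fst p)) \<in> ?N \<rightarrow>\<^sub>M prob_algebra (K_space \<Gamma>)" for j
      unfolding f_def by (rule measurable_compose[OF measurable_fst step])
    have "(\<lambda>p. f (snd p) (fst p)) \<in> ?N \<rightarrow>\<^sub>M prob_algebra (K_space \<Gamma>)"
      by (rule measurable_compose_countable'[OF f measurable_snd countable_finite[OF finite]])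
    then show "(\<lambda>(\<omega>, j). distr (\<sigma> m (\<omega>, j) \<Otimes>\<^sub>M \<tau> m (\<omega>, j)) (K_space \<Gamma>) (\<lambda>(a, b). (j, a, b))) \<in>
        (\<Pi>\<^sub>M t\<in>{0..<m}. K_space \<Gamma>) \<Otimes>\<^sub>M count_space UNIV \<rightarrow>\<^sub>M prob_algebra (K_space \<Gamma>)"
      by (simp add: f_def case_prod_beta')
  qed
  show ?thesis
  proof (rule Ionescu_Tulcea.intro)
    show "stage_law \<Gamma> \<sigma> \<tau> i m \<in> (\<Pi>\<^sub>M t\<in>{0..<m}. K_space \<Gamma>) \<rightarrow>\<^sub>M subprob_algebra (K_space \<Gamma>)" for m
      by (rule measurable_prob_algebraD[OF P])
    fix m :: nat and \<omega> assume "\<omega> \<in> space (\<Pi>\<^sub>M t\<in>{0..<m}. K_space \<Gamma>)"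
    from measurable_space[OF P this] show "prob_space (stage_law \<Gamma> \<sigma> \<tau> i m \<omega>)"
      by (simp add: space_prob_algebra)
  qed
qed

lemma prob_space_play_law:
  fixes \<Gamma> :: "('n::finite, 'a::polish_space, 'b::polish_space) stochastic_game"
  assumes "is_stochastic_game \<Gamma>" "max_strategy \<Gamma> \<sigma>" "min_strategy \<Gamma> \<tau>"
  shows "prob_space (play_law \<Gamma> \<sigma> \<tau> i)"
proof -
  interpret Ionescu_Tulcea "stage_law \<Gamma> \<sigma> \<tau> i" "\<lambda>_. K_space \<Gamma>"
    by (rule Ionescu_Tulcea_stage_law[OF assms])
  have "prob_space PF.lim"
    by (rule prob_space_distrD[of "\<lambda>x. restrict x {}" _ "PiM {} (\<lambda>_. K_space \<Gamma>)"])
      (auto simp: distr_lim intro!: PF.prob_space_P measurable_restrict cong: measurable_cong_sets)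
  then show ?thesis by (simp add: play_law_def)
qed

definition max_dominion ::
  "('n, 'a::polish_space, 'b::polish_space) stochastic_game \<Rightarrow> 'n set \<Rightarrow> bool" where
  "max_dominion \<Gamma> D \<longleftrightarrow> D \<noteq> {} \<and>
     (\<exists>\<sigma>. max_strategy \<Gamma> \<sigma> \<and>
        (\<forall>i\<in>D. \<forall>\<tau>. min_strategy \<Gamma> \<tau> \<longrightarrow> (AE \<omega> in play_law \<Gamma> \<sigma> \<tau> i. \<forall>m. fst (\<omega> m) \<in> D)))"

definition min_dominion ::
  "('n, 'a::polish_space, 'b::polish_space) stochastic_game \<Rightarrow> 'n set \<Rightarrow> bool" where
  "min_dominion \<Gamma> D \<longleftrightarrow> D \<noteq> {} \<and>
     (\<exists>\<tau>. min_strategy \<Gamma> \<tau> \<and>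
        (\<forall>i\<in>D. \<forall>\<sigma>. max_strategy \<Gamma> \<sigma> \<longrightarrow> (AE \<omega> in play_law \<Gamma> \<sigma> \<tau> i. \<forall>m. fst (\<omega> m) \<in> D)))"

definition usc_on :: "'x::topological_space set \<Rightarrow> ('x \<Rightarrow> real) \<Rightarrow> bool" where
  "usc_on S f \<longleftrightarrow> (\<forall>c. openin (top_of_set S) {x\<in>S. f x < c})"

definition lsc_on :: "'x::topological_space set \<Rightarrow> ('x \<Rightarrow> real) \<Rightarrow> bool" where
  "lsc_on S f \<longleftrightarrow> (\<forall>c. openin (top_of_set S) {x\<in>S. c < f x})"

end

theory Submission
  imports Defs
begin

text \<open>
  The Shapley operator \<open>T\<close> is topical: monotone and commuting with the addition of constants. A set
  \<open>D\<close> is a dominion of Max iff in each state of \<open>D\<close> Max has a single pure action that keeps the state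
  in \<open>D\<close> whatever Min does, and then \<open>T\<^sub>i\<close> is bounded below on \<open>D\<close> up to the minimum of the argument
  over \<open>D\<close>. If \<open>D\<close> is not a dominion, then in some state of \<open>D\<close> Min has, by compactness, a
  finitely supported mixed action that leaves \<open>D\<close> with probability bounded away from 0 against all
  actions of Max, so \<open>T\<^sub>i\<close> tends to \<open>- \<infinity>\<close> as the argument tends to \<open>- \<infinity>\<close> outside \<open>D\<close>. The
  situation for Min is symmetric.

  Given disjoint dominions \<open>D\<close> of Max and \<open>D'\<close> of Min, a perturbation \<open>g\<close> that is large on \<open>D\<close> and very
  negative on \<open>D'\<close> would force the constant in the ergodic equation to be both positive and negative.
  Conversely, a vector \<open>v\<close> with \<open>F v - v\<close> bounded, where \<open>F = g + T\<close>, and a large gap between its maximum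
  and its minimum has a dominion of Max among its top coordinates and one of Min among its bottom
  coordinates; if dominions always meet, the gap is bounded, and the vanishing discount limit solves
  the ergodic equation.
\<close>

section \<open>Topical maps\<close>

text \<open>One inequality packages both properties: \<open>c = 0\<close> gives monotonicity, and
  using it with \<open>c\<close> and with \<open>- c\<close> gives additive homogeneity. It also
  makes the map nonexpansive for the sup norm.\<close>

definition topical :: "(real ^ 'n \<Rightarrow> real ^ 'n) \<Rightarrow> bool" where
  "topical F \<longleftrightarrow> (\<forall>x y c i. (\<forall>l. x $ l \<le> y $ l + c) \<longrightarrow> F x $ i \<le> F y $ i + c)"

lemma topicalD:
  "topical F \<Longrightarrow> (\<And>l. x $ l \<le> y $ l + c) \<Longrightarrow> F x $ i \<le> F y $ i + c"
  unfolding topical_def by blast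

lemma topical_shift: "topical F \<Longrightarrow> topical (\<lambda>x. g + F x)"
  unfolding topical_def by auto

text \<open>Conjugation by the sign exchanges the players, so what is proved about the top
  coordinates of a vector transfers to the bottom ones.\<close>

lemma topical_conjugate:
  assumes "topical F"
  shows "topical (\<lambda>x. - F (- x))"
  unfolding topical_def
proof (intro allI impI)
  fix x y :: "real ^ 'a" and c i assume le: "\<forall>l. x $ l \<le> y $ l + c"
  have "F (- y) $ i \<le> F (- x) $ i + c"
  proof (rule topicalD[OF assms])
    fix l show "(- y) $ l \<le> (- x) $ l + c" using le[rule_format, of l] by simp
  qed
  then show "(- F (- x)) $ i \<le> (- F (- y)) $ i + c" by simp
qed

lemma topical_add_const:
  assumes "topical F"
  shows "F (x + c *\<^sub>R (\<chi> i. 1)) = F x + c *\<^sub>R (\<chi> i. 1)"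
proof -
  have "F (x + c *\<^sub>R (\<chi> i. 1)) $ i = F x $ i + c" for i
    using topicalD[OF assms, of "x + c *\<^sub>R (\<chi> i. 1)" x c i]
      topicalD[OF assms, of x "x + c *\<^sub>R (\<chi> i. 1)" "- c" i] by simp
  then show ?thesis by (simp add: vec_eq_iff)
qed

text \<open>Take for \<open>c\<close> a bound on the coordinate differences, which the Euclidean
  norm dominates.\<close>

lemma topical_continuous:
  fixes F :: "real ^ 'n::finite \<Rightarrow> real ^ 'n"
  assumes "topical F"
  shows "continuous_on S F"
proof -
  have "continuous_on S (\<lambda>x. F x $ i)" for i
  proof (rule continuous_onI)
    fix x and e :: real assume "x \<in> S" "0 < e"
    have "dist (F y $ i) (F x $ i) \<le> e" if "dist y x < e" for y
    proof -
      have "\<bar>y $ l - x $ l\<bar> \<le> e" for l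
        using component_le_norm_cart[of "y - x" l] that by (simp add: dist_norm)
      then have "y $ l \<le> x $ l + e" "x $ l \<le> y $ l + e" for l
        by (smt (verit))+
      then have "F y $ i \<le> F x $ i + e" "F x $ i \<le> F y $ i + e"
        by (auto intro: topicalD[OF assms])
      then show ?thesis by (simp add: dist_real_def)
    qed
    then show "\<exists>d>0. \<forall>x'\<in>S. dist x' x < d \<longrightarrow> dist (F x' $ i) (F x $ i) \<le> e"
      using \<open>0 < e\<close> by blast
  qed
  then have "continuous_on S (\<lambda>x. \<chi> i. F x $ i)"
    by (rule continuous_on_vec_lambda)
  then show ?thesis by simp
qed

section \<open>Discounted fixed points and the vanishing discount limit\<close>

text \<open>Brouwer's theorem for \<open>x \<mapsto> F ((1 - \<alpha>) x)\<close> on a cube gives a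
  fixed point \<open>u\<close>, and \<open>v\<close> is \<open>(1 - \<alpha>) u\<close>. The bound
  \<open>C\<close> on the residual of \<open>v\<close> does not depend on \<open>\<alpha>\<close>,
  which is what the limit needs.\<close>

lemma topical_discounted_fixpoint:
  fixes F :: "real ^ 'n::finite \<Rightarrow> real ^ 'n"
  assumes F: "topical F" and C: "\<And>i. \<bar>F 0 $ i\<bar> \<le> C" and \<alpha>: "0 < \<alpha>" "\<alpha> < 1"
  obtains v where "\<And>i. F v $ i = v $ i / (1 - \<alpha>)" "\<And>i. \<bar>F v $ i - v $ i\<bar> \<le> C"
proof -
  \<comment> \<open>Solves \<open>C + (1 - \<alpha>) * R = R\<close>, so that the cube of radius
    \<open>R\<close> is mapped into itself.\<close>
  define R where "R = C / \<alpha>"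
  have R: "C + (1 - \<alpha>) * R = R" using \<alpha> by (simp add: R_def field_simps)
  have "0 \<le> C" using C[of undefined] by linarith
  then have "0 \<le> R" using \<alpha> by (simp add: R_def)
  define S :: "(real ^ 'n) set" where "S = cbox (\<chi> i. - R) (\<chi> i. R)"
  have S: "x \<in> S \<longleftrightarrow> (\<forall>i. \<bar>x $ i\<bar> \<le> R)" for x
    by (auto simp: S_def mem_box_cart abs_le_iff) (smt (verit))+
  have "(\<lambda>x. F ((1 - \<alpha>) *\<^sub>R x)) \<in> S \<rightarrow> S"
  proof
    fix x assume "x \<in> S"
    then have x: "\<bar>(1 - \<alpha>) * x $ l\<bar> \<le> (1 - \<alpha>) * R" for l
      using \<alpha> by (simp add: S abs_mult)
    have "F ((1 - \<alpha>) *\<^sub>R x) $ i \<le> F 0 $ i + (1 - \<alpha>) * R"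
      "F 0 $ i \<le> F ((1 - \<alpha>) *\<^sub>R x) $ i + (1 - \<alpha>) * R" for i
    proof -
      have *: "(1 - \<alpha>) * x $ l \<le> (1 - \<alpha>) * R" "0 \<le> (1 - \<alpha>) * x $ l + (1 - \<alpha>) * R" for l
        using x[of l] by linarith+
      show "F ((1 - \<alpha>) *\<^sub>R x) $ i \<le> F 0 $ i + (1 - \<alpha>) * R"
        "F 0 $ i \<le> F ((1 - \<alpha>) *\<^sub>R x) $ i + (1 - \<alpha>) * R"
        by (intro topicalD[OF F]; use * in simp)+
    qed
    then have "\<bar>F ((1 - \<alpha>) *\<^sub>R x) $ i\<bar> \<le> R" for i
      using C[of i] R by (smt (verit))
    then show "F ((1 - \<alpha>) *\<^sub>R x) \<in> S" unfolding S by blast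
  qed
  moreover have "continuous_on S (\<lambda>x. F ((1 - \<alpha>) *\<^sub>R x))"
    by (intro continuous_on_compose2[OF topical_continuous[OF F, of UNIV]] continuous_intros) auto
  moreover have "compact S" "convex S" "S \<noteq> {}"
    using \<open>0 \<le> R\<close> S[of 0] by (auto simp: S_def)
  ultimately obtain u where u: "u \<in> S" "F ((1 - \<alpha>) *\<^sub>R u) = u"
    using brouwer[of S "\<lambda>x. F ((1 - \<alpha>) *\<^sub>R x)"] by blast
  \<comment> \<open>Since \<open>F ((1 - \<alpha>) u) = u\<close>, the residual is
    \<open>\<alpha> u\<close>, and \<open>\<alpha> R = C\<close>.\<close>
  have "\<bar>F ((1 - \<alpha>) *\<^sub>R u) $ i - ((1 - \<alpha>) *\<^sub>R u) $ i\<bar> \<le> C" for i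
  proof -
    have "\<bar>\<alpha> * u $ i\<bar> \<le> \<alpha> * R" using u(1) \<alpha> by (simp add: S abs_mult)
    then show ?thesis using \<alpha> unfolding u(2) by (simp add: R_def left_diff_distrib)
  qed
  then show ?thesis using that[of "(1 - \<alpha>) *\<^sub>R u"] \<alpha> unfolding u(2) by simp
qed

text \<open>Vanishing discount: a fixed point of \<open>x \<mapsto> F ((1 - \<alpha>) x)\<close> gives a point of a fixed slice,
  and normalised limits as \<open>\<alpha> \<rightarrow> 0\<close> solve the ergodic equation.\<close>

lemma ergodic_eq_solvable_if_slice_bounded:
  fixes F :: "real ^ 'n::finite \<Rightarrow> real ^ 'n"
  assumes F: "topical F"
    and bounded: "\<And>C. \<exists>R. \<forall>v. (\<forall>i. \<bar>F v $ i - v $ i\<bar> \<le> C) \<longrightarrow> (\<forall>i j. v $ i - v $ j \<le> R)"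
  shows "ergodic_eq_solvable F"
proof -
  define C where "C = (MAX i. \<bar>F 0 $ i\<bar>)"
  have C: "\<bar>F 0 $ i\<bar> \<le> C" for i unfolding C_def by (intro Max_ge) auto
  \<comment> \<open>Discount parameters tending to 0; the offset 2 keeps the first one below
    1.\<close>
  define \<alpha> where "\<alpha> k = 1 / real (k + 2)" for k
  have \<alpha>: "0 < \<alpha> k" "\<alpha> k < 1" for k by (auto simp: \<alpha>_def)
  have "\<exists>v. (\<forall>i. F v $ i = v $ i / (1 - \<alpha> k)) \<and> (\<forall>i. \<bar>F v $ i - v $ i\<bar> \<le> C)" for k
    using topical_discounted_fixpoint[OF F C \<alpha>] by metis
  then obtain v where v: "\<And>k i. F (v k) $ i = v k $ i / (1 - \<alpha> k)"
    and slice: "\<And>k i. \<bar>F (v k) $ i - v k $ i\<bar> \<le> C" by metis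
  obtain R where R: "\<And>k i j. v k $ i - v k $ j \<le> R" using bounded[of C] slice by blast
  obtain i0 :: 'n where True by simp
  \<comment> \<open>Subtracting coordinate \<open>i0\<close> keeps the sequence in one cube, by the
    bound \<open>R\<close> on the gaps, so a subsequence converges. By additive homogeneity the
    residuals do not change.\<close>
  define w where "w k = v k + (- v k $ i0) *\<^sub>R (\<chi> i. 1)" for k
  have "w k \<in> cbox (\<chi> i. - R) (\<chi> i. R)" for k
    using R[of k _ i0] R[of k i0] by (auto simp: w_def mem_box_cart algebra_simps)
  then obtain u r where r: "strict_mono (r :: nat \<Rightarrow> nat)" and u: "(w \<circ> r) \<longlonglongrightarrow> u"
    using compact_cbox[unfolded compact_def, rule_format, of w] by blast
  have Fw: "(\<lambda>k. F (w (r k))) \<longlonglongrightarrow> F u"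
    by (rule continuous_on_tendsto_compose[OF topical_continuous[OF F, of UNIV]])
      (use u in \<open>auto simp: comp_def\<close>)
  have diff: "F (w k) $ i - w k $ i = \<alpha> k / (1 - \<alpha> k) * v k $ i" for k i
    using \<alpha>[of k] by (simp add: w_def topical_add_const[OF F] v field_simps del: scaleR_minus_left)
  \<comment> \<open>Two coordinates of the residual differ by
    \<open>\<alpha> / (1 - \<alpha>)\<close> times a gap of size at most \<open>R\<close>. This
    tends to 0, so the residual of the limit \<open>u\<close> is a constant vector.\<close>
  have const: "F u $ i - u $ i = F u $ j - u $ j" for i j
  proof -
    let ?h = "\<lambda>k. (F (w (r k)) $ i - w (r k) $ i) - (F (w (r k)) $ j - w (r k) $ j)"
    have "?h \<longlonglongrightarrow> (F u $ i - u $ i) - (F u $ j - u $ j)"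
      by (intro tendsto_intros Fw u[unfolded comp_def])
    moreover have "?h \<longlonglongrightarrow> 0"
    proof (rule Lim_null_comparison)
      have "norm (?h k) \<le> \<alpha> (r k) / (1 - \<alpha> (r k)) * R" for k
      proof -
        have "?h k = \<alpha> (r k) / (1 - \<alpha> (r k)) * (v (r k) $ i - v (r k) $ j)"
          unfolding diff by (simp add: algebra_simps)
        moreover have "\<bar>v (r k) $ i - v (r k) $ j\<bar> \<le> R"
          using R[of "r k" i j] R[of "r k" j i] by linarith
        moreover have "0 \<le> \<alpha> (r k) / (1 - \<alpha> (r k))" using \<alpha>[of "r k"] by simp
        ultimately show ?thesis
          by (simp only: real_norm_def abs_mult abs_of_nonneg mult_left_mono)
      qed
      then show "\<forall>\<^sub>F k in sequentially. norm (?h k) \<le> \<alpha> (r k) / (1 - \<alpha> (r k)) * R" by simp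
      have "\<alpha> \<longlonglongrightarrow> 0"
        unfolding \<alpha>_def by (rule LIMSEQ_ignore_initial_segment[OF lim_1_over_n])
      then have "(\<lambda>k. \<alpha> (r k)) \<longlonglongrightarrow> 0"
        using LIMSEQ_subseq_LIMSEQ[OF _ r] by (simp add: comp_def)
      then have "(\<lambda>k. \<alpha> (r k) / (1 - \<alpha> (r k)) * R) \<longlonglongrightarrow> 0 / (1 - 0) * R"
        by (intro tendsto_intros) auto
      then show "(\<lambda>k. \<alpha> (r k) / (1 - \<alpha> (r k)) * R) \<longlonglongrightarrow> 0" by simp
    qed
    ultimately show ?thesis using LIMSEQ_unique by fastforce
  qed
  have "F u = (F u $ i0 - u $ i0) *\<^sub>R (\<chi> i. 1) + u"
  proof (simp add: vec_eq_iff, rule allI)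
    fix i show "F u $ i = F u $ i0 - u $ i0 + u $ i" using const[of i i0] by linarith
  qed
  then show ?thesis unfolding ergodic_eq_solvable_def by blast
qed

section \<open>Level sets of approximate solutions\<close>

text \<open>Test vector for leaving \<open>D\<close>: its mean under a transition law is
  \<open>s\<close> times the probability of leaving \<open>D\<close>, so a very negative or very
  large \<open>s\<close> detects whether exit can be forced.\<close>

definition level_vec :: "'n set \<Rightarrow> real \<Rightarrow> real ^ 'n" where
  "level_vec D s = (\<chi> l. if l \<in> D then 0 else s)"

text \<open>The level sets of a vector in the slice grow: if the set of coordinates within \<open>M\<close> of the maximum
  is not a dominion, one of its states escapes, and the slice inequality at that state forces a further
  coordinate to lie within a distance \<open>M'\<close> of the maximum that depends only on \<open>M\<close> and \<open>C\<close>.\<close>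

lemma top_level_set_step:
  fixes F :: "real ^ 'n::finite \<Rightarrow> real ^ 'n"
  assumes F: "topical F" and "0 \<le> M"
    and esc: "\<And>D. D \<noteq> {} \<Longrightarrow> \<not> P D \<Longrightarrow> \<exists>i\<in>D. \<forall>c. \<exists>s. F (level_vec D (- s)) $ i < c"
  shows "\<exists>M'\<ge>M. \<forall>v m. (\<forall>i. v $ i \<le> F v $ i + C) \<longrightarrow> (\<forall>i. v $ i \<le> m) \<longrightarrow> {i. m - M \<le> v $ i} \<noteq> {} \<longrightarrow>
    \<not> P {i. m - M \<le> v $ i} \<longrightarrow> {i. m - M \<le> v $ i} \<subset> {i. m - M' \<le> v $ i}"
proof -
  \<comment> \<open>At a state with \<open>m - M \<le> v $ i\<close> the slice inequality gives
    \<open>m - M - C \<le> F v $ i\<close>; after subtraction of \<open>m\<close>, this is the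
    threshold to undercut.\<close>
  have "\<forall>D. \<exists>s. D \<noteq> {} \<longrightarrow> \<not> P D \<longrightarrow> (\<exists>i\<in>D. F (level_vec D (- s)) $ i < - M - C)"
    using esc by metis
  then obtain s where s: "\<And>D. D \<noteq> {} \<Longrightarrow> \<not> P D \<Longrightarrow> \<exists>i\<in>D. F (level_vec D (- s D)) $ i < - M - C"
    by metis
  \<comment> \<open>There are finitely many sets of states, so one depth serves all
    \<open>D\<close>, independently of \<open>v\<close> and \<open>m\<close>.\<close>
  define M' where "M' = max M (Max (range s))"
  have M': "M \<le> M'" "\<And>D. s D \<le> M'" by (auto simp: M'_def le_max_iff_disj)
  have "{i. m - M \<le> v $ i} \<subset> {i. m - M' \<le> v $ i}"
    if v: "\<And>i. v $ i \<le> F v $ i + C" "\<And>i. v $ i \<le> m"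
      and ne: "{i. m - M \<le> v $ i} \<noteq> {}" "\<not> P {i. m - M \<le> v $ i}" for v m
  proof -
    define D where "D = {i. m - M \<le> v $ i}"
    obtain i where i: "i \<in> D" "F (level_vec D (- s D)) $ i < - M - C"
      using s[of D] ne unfolding D_def by blast
    have "\<exists>l. l \<notin> D \<and> m - s D \<le> v $ l"
    proof (rule ccontr)
      \<comment> \<open>Otherwise \<open>v\<close> lies below \<open>level_vec D (- s D)\<close>
        shifted by \<open>m\<close>, and topicality puts \<open>F v $ i\<close> below
        \<open>m - M - C\<close>, against
        \<open>m - M \<le> v $ i \<le> F v $ i + C\<close>.\<close>
      assume "\<not> ?thesis"
      then have "v $ l \<le> level_vec D (- s D) $ l + m" for l
        using v(2)[of l] by (force simp: level_vec_def not_le)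
      then have "F v $ i \<le> F (level_vec D (- s D)) $ i + m" by (rule topicalD[OF F])
      with i v(1)[of i] show False by (simp add: D_def)
    qed
    then obtain l where "l \<notin> D" "m - s D \<le> v $ l" by blast
    then have "l \<in> {i. m - M' \<le> v $ i} - D" using M'(2)[of D] by auto
    then show ?thesis using M'(1) by (auto simp: D_def)
  qed
  then show ?thesis using M'(1) by blast
qed

text \<open>Induction on a lower bound \<open>k\<close> for the size of the level set: as long as no
  set satisfying \<open>P\<close> is found, a larger depth adds at least one coordinate. More than
  \<open>CARD('n)\<close> coordinates are impossible. The depth stays uniform in \<open>v\<close>
  and \<open>m\<close>.\<close>

lemma top_level_set_dominion:
  fixes F :: "real ^ 'n::finite \<Rightarrow> real ^ 'n"
  assumes F: "topical F"
    and esc: "\<And>D. D \<noteq> {} \<Longrightarrow> \<not> P D \<Longrightarrow> \<exists>i\<in>D. \<forall>c. \<exists>s. F (level_vec D (- s)) $ i < c"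
  shows "\<exists>M. \<forall>v m. (\<forall>i. v $ i \<le> F v $ i + C) \<longrightarrow> (\<forall>i. v $ i \<le> m) \<longrightarrow> (\<exists>i. v $ i = m) \<longrightarrow>
    (\<exists>D. P D \<and> D \<noteq> {} \<and> (\<forall>i\<in>D. m - M \<le> v $ i))"
proof -
  have "\<exists>M\<ge>0. \<forall>v m. (\<forall>i. v $ i \<le> F v $ i + C) \<longrightarrow> (\<forall>i. v $ i \<le> m) \<longrightarrow> (\<exists>i. v $ i = m) \<longrightarrow>
    (\<exists>D. P D \<and> D \<noteq> {} \<and> (\<forall>i\<in>D. m - M \<le> v $ i)) \<or> k \<le> card {i. m - M \<le> v $ i}" for k
  proof (induction k)
    case 0
    show ?case by (auto intro!: exI[of _ 0])
  next
    case (Suc k)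
    then obtain M where M: "0 \<le> M" and IH: "\<And>v m. (\<forall>i. v $ i \<le> F v $ i + C) \<Longrightarrow> (\<forall>i. v $ i \<le> m) \<Longrightarrow>
      (\<exists>i. v $ i = m) \<Longrightarrow> (\<exists>D. P D \<and> D \<noteq> {} \<and> (\<forall>i\<in>D. m - M \<le> v $ i)) \<or> k \<le> card {i. m - M \<le> v $ i}"
      by blast
    obtain M' where M': "M \<le> M'" and step: "\<And>v m. (\<forall>i. v $ i \<le> F v $ i + C) \<Longrightarrow> (\<forall>i. v $ i \<le> m) \<Longrightarrow>
      {i. m - M \<le> v $ i} \<noteq> {} \<Longrightarrow> \<not> P {i. m - M \<le> v $ i} \<Longrightarrow> {i. m - M \<le> v $ i} \<subset> {i. m - M' \<le> v $ i}"
      using top_level_set_step[where P = P and C = C, OF F M esc] by blast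
    have "(\<exists>D. P D \<and> D \<noteq> {} \<and> (\<forall>i\<in>D. m - M' \<le> v $ i)) \<or> Suc k \<le> card {i. m - M' \<le> v $ i}"
      if v: "\<forall>i. v $ i \<le> F v $ i + C" "\<forall>i. v $ i \<le> m" "\<exists>i. v $ i = m" for v m
    proof (cases "(\<exists>D. P D \<and> D \<noteq> {} \<and> (\<forall>i\<in>D. m - M \<le> v $ i))")
      case True
      then show ?thesis using M' by (meson diff_left_mono order_trans)
    next
      case False
      obtain i where "v $ i = m" using v(3) by blast
      then have "i \<in> {i. m - M \<le> v $ i}" using M by simp
      then have ne: "{i. m - M \<le> v $ i} \<noteq> {}" by blast
      then have "\<not> P {i. m - M \<le> v $ i}" using False by blast
      from psubset_card_mono[OF _ step[OF v(1,2) ne this]] IH[OF v] False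
      show ?thesis by auto
    qed
    then show ?case using M M' by (intro exI[of _ M']) auto
  qed
  from this[of "Suc CARD('n)"] obtain M where M: "\<And>v m. (\<forall>i. v $ i \<le> F v $ i + C) \<Longrightarrow>
    (\<forall>i. v $ i \<le> m) \<Longrightarrow> (\<exists>i. v $ i = m) \<Longrightarrow>
    (\<exists>D. P D \<and> D \<noteq> {} \<and> (\<forall>i\<in>D. m - M \<le> v $ i)) \<or> Suc CARD('n) \<le> card {i. m - M \<le> v $ i}"
    by blast
  have "\<not> Suc CARD('n) \<le> card A" for A :: "'n set"
    using card_mono[of UNIV A] by auto
  then show ?thesis using M by blast
qed

text \<open>A vector \<open>v\<close> with residual at most \<open>C\<close> has a set satisfying
  \<open>P\<close> within \<open>M\<close> of its maximum; the conjugate map \<open>G\<close> at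
  \<open>- v\<close> gives a set satisfying \<open>Q\<close> within \<open>N\<close> of its minimum.
  A common state bounds the gap by \<open>M + N\<close>.\<close>

lemma ergodic_eq_solvable_if_no_disjoint:
  fixes F :: "real ^ 'n::finite \<Rightarrow> real ^ 'n"
  assumes F: "topical F"
    and P: "\<And>D. D \<noteq> {} \<Longrightarrow> \<not> P D \<Longrightarrow> \<exists>i\<in>D. \<forall>c. \<exists>s. F (level_vec D (- s)) $ i < c"
    and Q: "\<And>D. D \<noteq> {} \<Longrightarrow> \<not> Q D \<Longrightarrow> \<exists>i\<in>D. \<forall>c. \<exists>s. c < F (level_vec D s) $ i"
    and disj: "\<And>D D'. P D \<Longrightarrow> Q D' \<Longrightarrow> D \<noteq> {} \<Longrightarrow> D' \<noteq> {} \<Longrightarrow> D \<inter> D' \<noteq> {}"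
  shows "ergodic_eq_solvable F"
proof (rule ergodic_eq_solvable_if_slice_bounded[OF F])
  fix C
  define G where "G x = - F (- x)" for x
  have G: "topical G" unfolding G_def[abs_def] by (rule topical_conjugate[OF F])
  have Q': "\<exists>i\<in>D. \<forall>c. \<exists>s. G (level_vec D (- s)) $ i < c" if "D \<noteq> {}" "\<not> Q D" for D
  proof -
    obtain i where "i \<in> D" and i: "\<And>c. \<exists>s. c < F (level_vec D s) $ i" using Q[OF \<open>D \<noteq> {}\<close> \<open>\<not> Q D\<close>] by blast
    have "- level_vec D (- s) = level_vec D s" for s by (simp add: level_vec_def vec_eq_iff)
    then have "\<exists>s. G (level_vec D (- s)) $ i < c" for c
      using i[of "- c"] by (auto simp: G_def minus_less_iff)
    then show ?thesis using \<open>i \<in> D\<close> by blast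
  qed
  obtain M where M: "\<And>v m. (\<forall>i. v $ i \<le> F v $ i + C) \<Longrightarrow> (\<forall>i. v $ i \<le> m) \<Longrightarrow> (\<exists>i. v $ i = m) \<Longrightarrow>
    (\<exists>D. P D \<and> D \<noteq> {} \<and> (\<forall>i\<in>D. m - M \<le> v $ i))"
    using top_level_set_dominion[where P = P and C = C, OF F P] by blast
  obtain N where N: "\<And>v m. (\<forall>i. v $ i \<le> G v $ i + C) \<Longrightarrow> (\<forall>i. v $ i \<le> m) \<Longrightarrow> (\<exists>i. v $ i = m) \<Longrightarrow>
    (\<exists>D. Q D \<and> D \<noteq> {} \<and> (\<forall>i\<in>D. m - N \<le> v $ i))"
    using top_level_set_dominion[where P = Q and C = C, OF G Q'] by blast
  have "v $ i - v $ j \<le> M + N" if v: "\<And>i. \<bar>F v $ i - v $ i\<bar> \<le> C" for v i j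
  proof -
    define m m' where "m = (MAX i. v $ i)" and "m' = (MAX i. (- v) $ i)"
    have m: "\<forall>i. v $ i \<le> m" "\<exists>i. v $ i = m"
      unfolding m_def using Max_in[of "range (($) v)"] Max_ge[of "range (($) v)"]
      by (fastforce simp: image_iff)+
    have m': "\<forall>i. (- v) $ i \<le> m'" "\<exists>i. (- v) $ i = m'"
      unfolding m'_def using Max_in[of "range (($) (- v))"] Max_ge[of "range (($) (- v))"]
      by (fastforce simp: image_iff)+
    have "\<forall>i. v $ i \<le> F v $ i + C" "\<forall>i. (- v) $ i \<le> G (- v) $ i + C"
      using v by (auto simp: G_def abs_le_iff algebra_simps)
    with M[OF _ m] N[OF _ m'] obtain D D' where D: "P D" "D \<noteq> {}" "\<forall>i\<in>D. m - M \<le> v $ i"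
      and D': "Q D'" "D' \<noteq> {}" "\<forall>i\<in>D'. m' - N \<le> (- v) $ i" by blast
    obtain k where "k \<in> D" "k \<in> D'" using disj[OF D(1) D'(1) D(2) D'(2)] by blast
    with D(3) D'(3) have "m - M \<le> v $ k" "m' - N \<le> - v $ k" by auto
    moreover have "v $ i \<le> m" "- v $ j \<le> m'" using m(1) m'(1) by auto
    ultimately show ?thesis by linarith
  qed
  then show "\<exists>R. \<forall>v. (\<forall>i. \<bar>F v $ i - v $ i\<bar> \<le> C) \<longrightarrow> (\<forall>i j. v $ i - v $ j \<le> R)" by blast
qed

section \<open>Plays confined to a set of states\<close>

text \<open>One-stage form of confinement: its vanishing replaces almost sure statements about whole
  plays.\<close>

definition exit_prob :: "('n, 'a, 'b) stochastic_game \<Rightarrow> 'n set \<Rightarrow> 'n \<times> 'a \<times> 'b \<Rightarrow> real" where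
  "exit_prob \<Gamma> D k = measure (trans_law \<Gamma> k) (- D)"

lemma exit_prob_nonneg: "0 \<le> exit_prob \<Gamma> D k"
  by (simp add: exit_prob_def)

lemma space_K_space: "space (K_space \<Gamma>) = feasible \<Gamma>"
  by (simp add: K_space_def space_restrict_space space_pair_measure)

lemma trans_law_prob_algebra:
  "is_stochastic_game \<Gamma> \<Longrightarrow> k \<in> feasible \<Gamma> \<Longrightarrow> trans_law \<Gamma> k \<in> space (prob_algebra (count_space UNIV))"
  unfolding is_stochastic_game_def space_K_space[symmetric] by (blast dest: measurable_space)

lemma trans_law_props:
  assumes "is_stochastic_game \<Gamma>" "k \<in> feasible \<Gamma>"
  shows "prob_space (trans_law \<Gamma> k)" "sets (trans_law \<Gamma> k) = UNIV" "space (trans_law \<Gamma> k) = UNIV"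
  using trans_law_prob_algebra[OF assms] sets_eq_imp_space_eq[of "trans_law \<Gamma> k" "count_space UNIV"]
  by (auto simp: space_prob_algebra)

lemma AE_trans_law_iff:
  assumes "is_stochastic_game \<Gamma>" "k \<in> feasible \<Gamma>"
  shows "(AE j in trans_law \<Gamma> k. j \<in> D) \<longleftrightarrow> exit_prob \<Gamma> D k = 0"
proof -
  interpret prob_space "trans_law \<Gamma> k" by (rule trans_law_props(1)[OF assms])
  have "exit_prob \<Gamma> D k = 1 - prob D"
    using prob_compl[of D] by (simp add: exit_prob_def trans_law_props[OF assms] Compl_eq_Diff_UNIV)
  then show ?thesis using AE_in_set_eq_1[of D] by (auto simp: trans_law_props[OF assms])
qed

lemma measurable_exit_prob[measurable]:
  assumes "is_stochastic_game \<Gamma>"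
  shows "exit_prob \<Gamma> D \<in> borel_measurable (K_space \<Gamma>)"
proof -
  have "trans_law \<Gamma> \<in> K_space \<Gamma> \<rightarrow>\<^sub>M subprob_algebra (count_space UNIV)"
    using assms by (auto simp: is_stochastic_game_def intro: measurable_prob_algebraD)
  from measurable_compose[OF this measurable_measure_subprob_algebra[of "- D"]]
  show ?thesis by (simp add: exit_prob_def[abs_def])
qed

lemma measurable_feasible_embed:
  "(\<lambda>p. (j, p)) \<in> restrict_space borel (max_avail \<Gamma> j) \<Otimes>\<^sub>M restrict_space borel (min_avail \<Gamma> j)
    \<rightarrow>\<^sub>M K_space \<Gamma>"
  unfolding K_space_def
proof (intro measurable_restrict_space2 measurable_Pair)
  show "(\<lambda>p. p) \<in> restrict_space borel (max_avail \<Gamma> j) \<Otimes>\<^sub>M restrict_space borel (min_avail \<Gamma> j)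
      \<rightarrow>\<^sub>M borel \<Otimes>\<^sub>M borel"
    by (rule measurable_pair)
      (auto simp: comp_def intro!: measurable_compose[OF measurable_fst]
         measurable_compose[OF measurable_snd] measurable_restrict_space1)
qed (auto simp: space_pair_measure space_restrict_space feasible_def)

lemma max_strategy_props:
  assumes "max_strategy \<Gamma> \<sigma>" "\<omega> \<in> space (\<Pi>\<^sub>M t\<in>{0..<m}. K_space \<Gamma>)"
  shows "\<sigma> m (\<omega>, j) \<in> borel_probs (max_avail \<Gamma> j)"
  using assms unfolding max_strategy_def borel_probs_def by (blast dest: measurable_space)

lemma min_strategy_props:
  assumes "min_strategy \<Gamma> \<tau>" "\<omega> \<in> space (\<Pi>\<^sub>M t\<in>{0..<m}. K_space \<Gamma>)"
  shows "\<tau> m (\<omega>, j) \<in> borel_probs (min_avail \<Gamma> j)"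
  using assms unfolding min_strategy_def borel_probs_def by (blast dest: measurable_space)

lemma borel_probsD:
  assumes "\<mu> \<in> borel_probs X"
  shows "prob_space \<mu>" "sets \<mu> = sets (restrict_space borel X)" "space \<mu> = X"
  using assms by (auto simp: borel_probs_def space_prob_algebra space_restrict_space dest: sets_eq_imp_space_eq)

lemma state_law_props:
  assumes "is_stochastic_game \<Gamma>" "\<omega> \<in> space (\<Pi>\<^sub>M t\<in>{0..<m}. K_space \<Gamma>)"
  shows "sets (state_law \<Gamma> i m \<omega>) = UNIV"
proof (cases m)
  case (Suc k)
  then have "\<omega> k \<in> feasible \<Gamma>" using assms(2) by (auto simp: space_PiM PiE_iff space_K_space)
  then show ?thesis using Suc trans_law_props[OF assms(1)] by (simp add: state_law_def)
qed (simp add: state_law_def)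

lemma state_law_0: "state_law \<Gamma> i 0 \<omega> = return (count_space UNIV) i"
  and state_law_Suc: "state_law \<Gamma> i (Suc k) \<omega> = trans_law \<Gamma> (\<omega> k)"
  by (simp_all add: state_law_def)

text \<open>The stage law draws a state and then an independent pair of actions; the kernel is
  measurable in the state because the state space is discrete.\<close>

lemma AE_stage_law_iff:
  assumes \<Gamma>: "is_stochastic_game \<Gamma>" and \<sigma>: "max_strategy \<Gamma> \<sigma>" and \<tau>: "min_strategy \<Gamma> \<tau>"
    and \<omega>: "\<omega> \<in> space (\<Pi>\<^sub>M t\<in>{0..<m}. K_space \<Gamma>)" and Q[measurable]: "Measurable.pred (K_space \<Gamma>) Q"
  shows "(AE x in stage_law \<Gamma> \<sigma> \<tau> i m \<omega>. Q x) \<longleftrightarrow>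
    (AE j in state_law \<Gamma> i m \<omega>. AE p in \<sigma> m (\<omega>, j) \<Otimes>\<^sub>M \<tau> m (\<omega>, j). Q (j, p))"
proof -
  note s = borel_probsD[OF max_strategy_props[OF \<sigma> \<omega>]] and t = borel_probsD[OF min_strategy_props[OF \<tau> \<omega>]]
  have emb: "(\<lambda>(a, b). (j, a, b)) \<in> \<sigma> m (\<omega>, j) \<Otimes>\<^sub>M \<tau> m (\<omega>, j) \<rightarrow>\<^sub>M K_space \<Gamma>" for j
    using measurable_feasible_embed[of j \<Gamma>]
    by (simp add: measurable_cong_sets[OF sets_pair_measure_cong[OF s(2) t(2)] refl] case_prod_beta')
  have "prob_space (\<sigma> m (\<omega>, j) \<Otimes>\<^sub>M \<tau> m (\<omega>, j))" for j
    using s(1) t(1) by (intro prob_space_pair)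
  then have kernel: "distr (\<sigma> m (\<omega>, j) \<Otimes>\<^sub>M \<tau> m (\<omega>, j)) (K_space \<Gamma>) (\<lambda>(a, b). (j, a, b))
      \<in> space (subprob_algebra (K_space \<Gamma>))" for j
    using prob_space.prob_space_distr[OF _ emb] by (simp add: space_subprob_algebra prob_space_imp_subprob_space)
  have "(\<lambda>j. distr (\<sigma> m (\<omega>, j) \<Otimes>\<^sub>M \<tau> m (\<omega>, j)) (K_space \<Gamma>) (\<lambda>(a, b). (j, a, b)))
      \<in> state_law \<Gamma> i m \<omega> \<rightarrow>\<^sub>M subprob_algebra (K_space \<Gamma>)"
    using kernel state_law_props[OF \<Gamma> \<omega>, of i]
    by (subst measurable_cong_sets[of _ "count_space UNIV" _ "subprob_algebra (K_space \<Gamma>)"])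
      (auto simp: measurable_count_space_eq1)
  from AE_bind[OF this Q] show ?thesis
    unfolding stage_law_def
    by (simp add: AE_distr_iff[OF emb] Q[unfolded pred_def] case_prod_beta')
qed

section \<open>Almost sure statements through finite prefixes of a play\<close>

text \<open>The marginal of the projective limit on the first \<open>n\<close> stages is the
  \<open>n\<close>-step law of the Ionescu-Tulcea construction, where statements about finitely many
  stages can be checked by induction.\<close>

lemma AE_play_law_prefix:
  assumes \<Gamma>: "is_stochastic_game \<Gamma>" and \<sigma>: "max_strategy \<Gamma> \<sigma>" and \<tau>: "min_strategy \<Gamma> \<tau>"
    and Q: "Measurable.pred (\<Pi>\<^sub>M t\<in>{0..<n}. K_space \<Gamma>) Q"
  shows "(AE \<omega> in play_law \<Gamma> \<sigma> \<tau> i. Q (restrict \<omega> {0..<n})) \<longleftrightarrow>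
    (AE \<omega> in Ionescu_Tulcea.C (stage_law \<Gamma> \<sigma> \<tau> i) (\<lambda>_. K_space \<Gamma>) 0 n (\<lambda>_. undefined). Q \<omega>)"
proof -
  interpret Ionescu_Tulcea "stage_law \<Gamma> \<sigma> \<tau> i" "\<lambda>_. K_space \<Gamma>"
    by (rule Ionescu_Tulcea_stage_law[OF \<Gamma> \<sigma> \<tau>])
  \<comment> \<open>\<open>CI J\<close> restricts the law of the first \<open>up_to J\<close> stages
    to \<open>J\<close>; for an initial segment it is therefore \<open>C 0 n\<close> itself.\<close>
  have "up_to {0..<n} = n"
  proof (rule antisym)
    show "up_to {0..<n} \<le> n" by (simp add: up_to_iff_Ico)
    show "n \<le> up_to {0..<n}" using up_to[of "{0..<n}"] by (auto simp: subset_eq)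
  qed
  then have "CI {0..<n} = C 0 n (\<lambda>_. undefined)"
    using distr_C[of n n "\<lambda>_. undefined" 0] by (simp add: CI_def)
  then have "C 0 n (\<lambda>_. undefined) = distr (play_law \<Gamma> \<sigma> \<tau> i) (\<Pi>\<^sub>M t\<in>{0..<n}. K_space \<Gamma>) (\<lambda>\<omega>. restrict \<omega> {0..<n})"
    using distr_lim[of "{0..<n}"] by (simp add: play_law_def)
  moreover have "(\<lambda>\<omega>. restrict \<omega> {0..<n}) \<in> play_law \<Gamma> \<sigma> \<tau> i \<rightarrow>\<^sub>M PiM {0..<n} (\<lambda>_. K_space \<Gamma>)"
    unfolding play_law_def measurable_cong_sets[OF PF.sets_lim refl]
    by (rule measurable_restrict_subset) simp
  ultimately show ?thesis using Q
    by (simp only:) (subst AE_distr_iff, simp_all add: pred_def)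
qed

text \<open>One step of the construction: the longer law binds the shorter one with
  \<open>eP n\<close>, the image of the stage law under \<open>fun_upd \<omega> n\<close>.\<close>

lemma AE_prefix_law_Suc:
  assumes \<Gamma>: "is_stochastic_game \<Gamma>" and \<sigma>: "max_strategy \<Gamma> \<sigma>" and \<tau>: "min_strategy \<Gamma> \<tau>"
    and Q: "Measurable.pred (\<Pi>\<^sub>M t\<in>{0..<Suc n}. K_space \<Gamma>) Q"
  shows "(AE \<omega> in Ionescu_Tulcea.C (stage_law \<Gamma> \<sigma> \<tau> i) (\<lambda>_. K_space \<Gamma>) 0 (Suc n) (\<lambda>_. undefined). Q \<omega>) \<longleftrightarrow>
    (AE \<omega> in Ionescu_Tulcea.C (stage_law \<Gamma> \<sigma> \<tau> i) (\<lambda>_. K_space \<Gamma>) 0 n (\<lambda>_. undefined).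
      AE x in stage_law \<Gamma> \<sigma> \<tau> i n \<omega>. Q (fun_upd \<omega> n x))"
proof -
  interpret Ionescu_Tulcea "stage_law \<Gamma> \<sigma> \<tau> i" "\<lambda>_. K_space \<Gamma>"
    by (rule Ionescu_Tulcea_stage_law[OF \<Gamma> \<sigma> \<tau>])
  have sp: "space (C 0 n (\<lambda>_. undefined)) = space (\<Pi>\<^sub>M t\<in>{0..<n}. K_space \<Gamma>)"
    using space_C[of "\<lambda>_. undefined" 0 n] by simp
  have "eP n \<in> C 0 n (\<lambda>_. undefined) \<rightarrow>\<^sub>M subprob_algebra (\<Pi>\<^sub>M t\<in>{0..<Suc n}. K_space \<Gamma>)"
    by (subst measurable_cong_sets[OF sets_C refl]) (simp_all add: measurable_eP)
  from AE_bind[OF this Q] have "(AE \<omega> in C 0 (Suc n) (\<lambda>_. undefined). Q \<omega>) \<longleftrightarrow>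
      (AE \<omega> in C 0 n (\<lambda>_. undefined). AE \<omega>' in eP n \<omega>. Q \<omega>')"
    by (simp only: C.simps(2) add_0)
  also have "\<dots> \<longleftrightarrow> (AE \<omega> in C 0 n (\<lambda>_. undefined). AE x in stage_law \<Gamma> \<sigma> \<tau> i n \<omega>. Q (fun_upd \<omega> n x))"
  proof (rule AE_cong)
    fix \<omega> assume "\<omega> \<in> space (C 0 n (\<lambda>_. undefined))"
    then have \<omega>: "\<omega> \<in> space (\<Pi>\<^sub>M t\<in>{0..<n}. K_space \<Gamma>)" by (simp add: sp)
    have "fun_upd \<omega> n \<in> stage_law \<Gamma> \<sigma> \<tau> i n \<omega> \<rightarrow>\<^sub>M (\<Pi>\<^sub>M t\<in>{0..<Suc n}. K_space \<Gamma>)"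
      unfolding measurable_cong_sets[OF sets_P[OF \<omega>] refl]
      by (rule measurable_fun_upd[where J="{0..<n}"]) (use \<omega> in auto)
    then show "(AE \<omega>' in eP n \<omega>. Q \<omega>') \<longleftrightarrow> (AE x in stage_law \<Gamma> \<sigma> \<tau> i n \<omega>. Q (fun_upd \<omega> n x))"
      unfolding eP_def by (rule AE_distr_iff) (use Q in \<open>simp add: pred_def\<close>)
  qed
  finally show ?thesis .
qed

lemma space_prefix_law:
  assumes "is_stochastic_game \<Gamma>" "max_strategy \<Gamma> \<sigma>" "min_strategy \<Gamma> \<tau>"
  shows "space (Ionescu_Tulcea.C (stage_law \<Gamma> \<sigma> \<tau> i) (\<lambda>_. K_space \<Gamma>) 0 n (\<lambda>_. undefined)) =
    space (\<Pi>\<^sub>M t\<in>{0..<n}. K_space \<Gamma>)"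
proof -
  interpret Ionescu_Tulcea "stage_law \<Gamma> \<sigma> \<tau> i" "\<lambda>_. K_space \<Gamma>"
    by (rule Ionescu_Tulcea_stage_law[OF assms])
  show ?thesis using space_C[of "\<lambda>_. undefined" 0 n] by simp
qed

text \<open>The space of empty histories has the single point \<open>\<lambda>_. undefined\<close>,
  on which every predicate is measurable.\<close>

lemma AE_prefix_law_0:
  assumes "is_stochastic_game \<Gamma>" "max_strategy \<Gamma> \<sigma>" "min_strategy \<Gamma> \<tau>"
  shows "(AE \<omega> in Ionescu_Tulcea.C (stage_law \<Gamma> \<sigma> \<tau> i) (\<lambda>_. K_space \<Gamma>) 0 0 (\<lambda>_. undefined). Q \<omega>) \<longleftrightarrow>
    Q (\<lambda>_. undefined)"
proof -
  interpret Ionescu_Tulcea "stage_law \<Gamma> \<sigma> \<tau> i" "\<lambda>_. K_space \<Gamma>"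
    by (rule Ionescu_Tulcea_stage_law[OF assms])
  have "Measurable.pred (PiM {} (\<lambda>_. K_space \<Gamma>)) Q"
    by (simp add: pred_def space_PiM_empty sets_PiM_empty) auto
  then have "(AE \<omega> in return (PiM {} (\<lambda>_. K_space \<Gamma>)) (\<lambda>_. undefined). Q \<omega>) \<longleftrightarrow> Q (\<lambda>_. undefined)"
    by (intro AE_return) (simp add: space_PiM)
  then show ?thesis by (simp only: C.simps(1) atLeastLessThan0)
qed

lemma pred_component:
  "Measurable.pred M G \<Longrightarrow> t \<in> I \<Longrightarrow> Measurable.pred (\<Pi>\<^sub>M t\<in>I. M) (\<lambda>\<omega>. G (\<omega> t))"
  by (rule measurable_compose[where f = "\<lambda>\<omega>. \<omega> t" and N = M]) simp_all

text \<open>Induction over prefixes: a triple with zero exit probability puts the next state in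
  \<open>D\<close> almost surely, and \<open>moves\<close> then gives zero exit probability again.
  Countably many prefixes cover the whole play.\<close>

lemma AE_confined_if_moves_confined:
  assumes \<Gamma>: "is_stochastic_game \<Gamma>" and \<sigma>: "max_strategy \<Gamma> \<sigma>" and \<tau>: "min_strategy \<Gamma> \<tau>"
    and i: "i \<in> D"
    and moves: "\<And>m \<omega> j. \<omega> \<in> space (\<Pi>\<^sub>M t\<in>{0..<m}. K_space \<Gamma>) \<Longrightarrow> j \<in> D \<Longrightarrow>
      AE p in \<sigma> m (\<omega>, j) \<Otimes>\<^sub>M \<tau> m (\<omega>, j). exit_prob \<Gamma> D (j, p) = 0"
  shows "AE \<omega> in play_law \<Gamma> \<sigma> \<tau> i. \<forall>m. fst (\<omega> m) \<in> D"
proof -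
  let ?C = "\<lambda>n. Ionescu_Tulcea.C (stage_law \<Gamma> \<sigma> \<tau> i) (\<lambda>_. K_space \<Gamma>) 0 n (\<lambda>_. undefined)"
  \<comment> \<open>Membership in \<open>D\<close> alone is not inductive: zero exit probability of
    the chosen actions is what carries confinement to the next stage.\<close>
  define G where "G k \<longleftrightarrow> fst k \<in> D \<and> exit_prob \<Gamma> D k = 0" for k
  have fst: "fst \<in> K_space \<Gamma> \<rightarrow>\<^sub>M count_space UNIV"
    unfolding K_space_def by (intro measurable_restrict_space1 measurable_fst)
  have G: "Measurable.pred (K_space \<Gamma>) G"
    unfolding G_def using fst measurable_exit_prob[OF \<Gamma>, of D] by measurable
  have Gn: "Measurable.pred (\<Pi>\<^sub>M t\<in>{0..<n}. K_space \<Gamma>) (\<lambda>\<omega>. \<forall>t\<in>{0..<n}. G (\<omega> t))" for n :: nat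
    by (intro pred_intros_finite pred_component[OF G]) auto
  have "AE \<omega> in ?C n. \<forall>t\<in>{0..<n}. G (\<omega> t)" for n
  proof (induction n)
    case (Suc n)
    have "AE \<omega> in ?C n. AE x in stage_law \<Gamma> \<sigma> \<tau> i n \<omega>. \<forall>t\<in>{0..<Suc n}. G ((fun_upd \<omega> n x) t)"
      using Suc
    proof (rule AE_mp[OF _ AE_I2], intro impI)
      fix \<omega> assume "\<omega> \<in> space (?C n)" and past: "\<forall>t\<in>{0..<n}. G (\<omega> t)"
      then have \<omega>: "\<omega> \<in> space (\<Pi>\<^sub>M t\<in>{0..<n}. K_space \<Gamma>)"
        by (simp add: space_prefix_law[OF \<Gamma> \<sigma> \<tau>])
      \<comment> \<open>Stage 0 starts at \<open>i\<close>; a later state is drawn from the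
        transition law of the preceding triple, whose exit probability vanishes by the
        invariant.\<close>
      have "AE j in state_law \<Gamma> i n \<omega>. j \<in> D"
      proof (cases n)
        case 0
        then show ?thesis using i unfolding 0 state_law_0 by (subst AE_return) auto
      next
        case (Suc k)
        then have "\<omega> k \<in> feasible \<Gamma>" "exit_prob \<Gamma> D (\<omega> k) = 0"
          using \<omega> past by (auto simp: space_PiM PiE_iff space_K_space G_def)
        then show ?thesis unfolding Suc state_law_Suc by (simp add: AE_trans_law_iff[OF \<Gamma>])
      qed
      then have "AE j in state_law \<Gamma> i n \<omega>. AE p in \<sigma> n (\<omega>, j) \<Otimes>\<^sub>M \<tau> n (\<omega>, j). G (j, p)"
      proof (rule AE_mp[OF _ AE_I2], intro impI)
        fix j assume "j \<in> D"
        then show "AE p in \<sigma> n (\<omega>, j) \<Otimes>\<^sub>M \<tau> n (\<omega>, j). G (j, p)"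
          using moves[OF \<omega>, of j] by (simp add: G_def)
      qed
      then have "AE x in stage_law \<Gamma> \<sigma> \<tau> i n \<omega>. G x"
        unfolding AE_stage_law_iff[OF \<Gamma> \<sigma> \<tau> \<omega> G] .
      then show "AE x in stage_law \<Gamma> \<sigma> \<tau> i n \<omega>. \<forall>t\<in>{0..<Suc n}. G ((fun_upd \<omega> n x) t)"
        by (rule AE_mp) (use past in \<open>auto intro!: AE_I2\<close>)
    qed
    then show ?case unfolding AE_prefix_law_Suc[OF \<Gamma> \<sigma> \<tau> Gn] .
  qed simp
  then have "AE \<omega> in play_law \<Gamma> \<sigma> \<tau> i. \<forall>t\<in>{0..<n}. G (restrict \<omega> {0..<n} t)" for n
    unfolding AE_play_law_prefix[OF \<Gamma> \<sigma> \<tau> Gn, symmetric] .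
  then have "AE \<omega> in play_law \<Gamma> \<sigma> \<tau> i. \<forall>n. \<forall>t\<in>{0..<n}. G (restrict \<omega> {0..<n} t)"
    by (simp only: AE_all_countable) simp
  then show ?thesis
  proof (rule AE_mp, intro AE_I2 impI allI)
    fix \<omega> :: "nat \<Rightarrow> _" and m assume "\<forall>n. \<forall>t\<in>{0..<n}. G (restrict \<omega> {0..<n} t)"
    then have "G (restrict \<omega> {0..<Suc m} m)" by (auto dest!: spec[of _ "Suc m"])
    then show "fst (\<omega> m) \<in> D" by (simp add: G_def)
  qed
qed

text \<open>Only the state at stage 1 matters: if it is almost surely in \<open>D\<close>, the
  transition law of the first triple almost surely gives no mass to the complement. Every state of a
  dominion may serve as initial state, so this suffices to read off an action there.\<close>

lemma AE_first_move_confined: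
  assumes \<Gamma>: "is_stochastic_game \<Gamma>" and \<sigma>: "max_strategy \<Gamma> \<sigma>" and \<tau>: "min_strategy \<Gamma> \<tau>"
    and conf: "AE \<omega> in play_law \<Gamma> \<sigma> \<tau> i. \<forall>m. fst (\<omega> m) \<in> D"
  shows "AE p in \<sigma> 0 (\<lambda>_. undefined, i) \<Otimes>\<^sub>M \<tau> 0 (\<lambda>_. undefined, i). exit_prob \<Gamma> D (i, p) = 0"
proof -
  let ?C = "\<lambda>n. Ionescu_Tulcea.C (stage_law \<Gamma> \<sigma> \<tau> i) (\<lambda>_. K_space \<Gamma>) 0 n (\<lambda>_. undefined)"
  have fst: "fst \<in> K_space \<Gamma> \<rightarrow>\<^sub>M count_space UNIV"
    unfolding K_space_def by (intro measurable_restrict_space1 measurable_fst)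
  then have D: "Measurable.pred (K_space \<Gamma>) (\<lambda>k. fst k \<in> D)" by measurable
  have D': "Measurable.pred (\<Pi>\<^sub>M t\<in>{0..<Suc (Suc 0)}. K_space \<Gamma>) (\<lambda>\<omega>. fst (\<omega> (Suc 0)) \<in> D)"
    by (rule pred_component[OF D]) simp
  have E: "Measurable.pred (K_space \<Gamma>) (\<lambda>k. exit_prob \<Gamma> D k = 0)"
    using measurable_exit_prob[OF \<Gamma>, of D] by measurable
  have E': "Measurable.pred (\<Pi>\<^sub>M t\<in>{0..<Suc 0}. K_space \<Gamma>) (\<lambda>\<omega>. exit_prob \<Gamma> D (\<omega> 0) = 0)"
    by (rule pred_component[OF E]) simp
  have "AE \<omega> in play_law \<Gamma> \<sigma> \<tau> i. fst (restrict \<omega> {0..<Suc (Suc 0)} (Suc 0)) \<in> D"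
    using conf by (rule AE_mp) simp
  then have "AE \<omega> in ?C (Suc (Suc 0)). fst (\<omega> (Suc 0)) \<in> D"
    unfolding AE_play_law_prefix[OF \<Gamma> \<sigma> \<tau> D'] .
  then have "AE \<omega> in ?C (Suc 0). AE x in stage_law \<Gamma> \<sigma> \<tau> i (Suc 0) \<omega>. fst x \<in> D"
    unfolding AE_prefix_law_Suc[OF \<Gamma> \<sigma> \<tau> D'] by simp
  then have "AE \<omega> in ?C (Suc 0). exit_prob \<Gamma> D (\<omega> 0) = 0"
  proof (rule AE_mp, intro AE_I2 impI)
    fix \<omega> assume "\<omega> \<in> space (?C (Suc 0))" and st: "AE x in stage_law \<Gamma> \<sigma> \<tau> i (Suc 0) \<omega>. fst x \<in> D"
    then have \<omega>: "\<omega> \<in> space (\<Pi>\<^sub>M t\<in>{0..<Suc 0}. K_space \<Gamma>)"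
      by (simp add: space_prefix_law[OF \<Gamma> \<sigma> \<tau>])
    have "prob_space (\<sigma> (Suc 0) (\<omega>, j) \<Otimes>\<^sub>M \<tau> (Suc 0) (\<omega>, j))" for j
      by (intro prob_space_pair borel_probsD(1)[OF max_strategy_props[OF \<sigma> \<omega>]]
          borel_probsD(1)[OF min_strategy_props[OF \<tau> \<omega>]])
    then have "AE j in state_law \<Gamma> i (Suc 0) \<omega>. j \<in> D"
      using st unfolding AE_stage_law_iff[OF \<Gamma> \<sigma> \<tau> \<omega> D] by (simp add: prob_space.AE_const)
    moreover have "\<omega> 0 \<in> feasible \<Gamma>" using \<omega> by (auto simp: space_PiM PiE_iff space_K_space)
    ultimately show "exit_prob \<Gamma> D (\<omega> 0) = 0"
      using AE_trans_law_iff[OF \<Gamma>, of "\<omega> 0" D] unfolding state_law_Suc by blast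
  qed
  then have "AE x in stage_law \<Gamma> \<sigma> \<tau> i 0 (\<lambda>_. undefined). exit_prob \<Gamma> D x = 0"
    unfolding AE_prefix_law_Suc[OF \<Gamma> \<sigma> \<tau> E'] AE_prefix_law_0[OF \<Gamma> \<sigma> \<tau>] by simp
  then have "AE j in return (count_space UNIV) i. AE p in \<sigma> 0 (\<lambda>_. undefined, j) \<Otimes>\<^sub>M \<tau> 0 (\<lambda>_. undefined, j).
      exit_prob \<Gamma> D (j, p) = 0"
    by (subst (asm) AE_stage_law_iff[OF \<Gamma> \<sigma> \<tau> _ E]) (simp_all only: state_law_0, simp add: space_PiM)
  then show ?thesis by (simp add: AE_return)
qed

section \<open>Semicontinuity and finite mixtures\<close>

lemma lsc_on_uminus: "lsc_on S (\<lambda>x. - f x) \<longleftrightarrow> usc_on S f"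
proof -
  have "{x \<in> S. c < - f x} = {x \<in> S. f x < - c}" "{x \<in> S. f x < c} = {x \<in> S. - c < - f x}" for c
    by auto
  then show ?thesis unfolding lsc_on_def usc_on_def by metis
qed

lemma lsc_on_const: "lsc_on S (\<lambda>_. c)"
  unfolding lsc_on_def by (simp add: Collect_conj_eq)

lemma lsc_on_add:
  assumes "lsc_on S f" "lsc_on S g"
  shows "lsc_on S (\<lambda>x. f x + g x)"
  unfolding lsc_on_def
proof
  fix c
  \<comment> \<open>Any \<open>q\<close> strictly between \<open>c - g x\<close> and
    \<open>f x\<close> splits the bound on the sum into two strict bounds.\<close>
  have "{x \<in> S. c < f x + g x} = (\<Union>q. {x \<in> S. q < f x} \<inter> {x \<in> S. c - q < g x})"
  proof (intro set_eqI iffI)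
    fix x assume "x \<in> {x \<in> S. c < f x + g x}"
    then have "x \<in> S" "c - g x < f x" by auto
    moreover then obtain q where "c - g x < q" "q < f x" using dense by blast
    ultimately show "x \<in> (\<Union>q. {x \<in> S. q < f x} \<inter> {x \<in> S. c - q < g x})"
      by (auto intro!: exI[of _ q])
  qed auto
  then show "openin (top_of_set S) {x \<in> S. c < f x + g x}"
    using assms by (auto simp: lsc_on_def simp del: Union_iff intro!: openin_Union openin_Int)
qed

lemma lsc_on_sum:
  "(\<And>i. i \<in> I \<Longrightarrow> lsc_on S (f i)) \<Longrightarrow> lsc_on S (\<lambda>x. \<Sum>i\<in>I. f i x)"
  by (induction I rule: infinite_finite_induct) (auto intro: lsc_on_const lsc_on_add)

lemma lsc_on_open_trace:
  assumes "lsc_on S f"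
  obtains U where "open U" "\<And>x. x \<in> S \<Longrightarrow> x \<in> U \<longleftrightarrow> c < f x"
proof -
  obtain U where "open U" "{x \<in> S. c < f x} = S \<inter> U"
    using assms unfolding lsc_on_def openin_open by metis
  then show ?thesis by (intro that) auto
qed

text \<open>The sets where \<open>f\<close> exceeds \<open>- n\<close> are relatively open and cover
  \<open>S\<close>; the largest index in a finite subcover gives the bound.\<close>

lemma lsc_on_compact_bounded_below:
  assumes "compact S" "lsc_on S f"
  obtains c where "0 \<le> c" "\<And>x. x \<in> S \<Longrightarrow> - c \<le> f x"
proof -
  have "\<forall>n :: nat. \<exists>U. open U \<and> (\<forall>x\<in>S. x \<in> U \<longleftrightarrow> - real n < f x)"
    using lsc_on_open_trace[OF assms(2)] by metis
  then obtain U where U: "\<And>n. open (U n)" "\<And>n x. x \<in> S \<Longrightarrow> x \<in> U n \<longleftrightarrow> - real n < f x"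
    by metis
  have "\<exists>n. - real n < f x" for x
    using reals_Archimedean2[of "- f x"] by (auto simp: minus_less_iff)
  then have "S \<subseteq> (\<Union>n. U n)" using U(2) by blast
  from compactE_image[OF assms(1) _ this] U(1)
  obtain C where C: "finite C" "S \<subseteq> (\<Union>n\<in>C. U n)" by metis
  have "- real (Max (insert 0 C)) \<le> f x" if x: "x \<in> S" for x
  proof -
    obtain n where n: "n \<in> C" "x \<in> U n" using C(2) x by blast
    then have "- real n < f x" using U(2)[OF x] by blast
    moreover have "real n \<le> real (Max (insert 0 C))" using n C(1) by (simp add: le_max_iff_disj)
    ultimately show ?thesis by linarith
  qed
  then show ?thesis using that[of "real (Max (insert 0 C))"] by auto
qed

lemma usc_on_compact_bounded_above:
  assumes "compact S" "usc_on S f"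
  obtains c where "0 \<le> c" "\<And>x. x \<in> S \<Longrightarrow> f x \<le> c"
  using lsc_on_compact_bounded_below[of S "\<lambda>x. - f x"] assms lsc_on_uminus[of S f]
  by (metis neg_le_iff_le)

text \<open>Each \<open>a\<close> has a \<open>b\<close> with \<open>f a b\<close> positive, and
  half of that value persists near \<open>a\<close>. A finite subcover leaves finitely many
  \<open>b\<close> and a positive minimum of the halves. The set \<open>S\<close> will support a
  mixed action.\<close>

lemma lsc_on_finite_cover:
  assumes "compact A" "A \<noteq> {}" "\<And>b. b \<in> B \<Longrightarrow> lsc_on A (\<lambda>a. f a b)"
    and pos: "\<And>a. a \<in> A \<Longrightarrow> \<exists>b\<in>B. (0::real) < f a b"
  obtains S \<delta> where "finite S" "S \<noteq> {}" "S \<subseteq> B" "0 < \<delta>" "\<And>a. a \<in> A \<Longrightarrow> \<exists>b\<in>S. \<delta> \<le> f a b"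
proof -
  obtain b where b: "\<And>a. a \<in> A \<Longrightarrow> b a \<in> B" "\<And>a. a \<in> A \<Longrightarrow> 0 < f a (b a)" using pos by metis
  have "\<forall>a\<in>A. \<exists>U. open U \<and> (\<forall>x\<in>A. x \<in> U \<longleftrightarrow> f a (b a) / 2 < f x (b a))"
    using lsc_on_open_trace[OF assms(3)] b(1) by metis
  then obtain U where U: "\<And>a. a \<in> A \<Longrightarrow> open (U a)"
    "\<And>a x. a \<in> A \<Longrightarrow> x \<in> A \<Longrightarrow> x \<in> U a \<longleftrightarrow> f a (b a) / 2 < f x (b a)" by metis
  have "A \<subseteq> (\<Union>a\<in>A. U a)" using U(2) b(2) by fastforce
  then obtain C where C: "C \<subseteq> A" "finite C" "A \<subseteq> (\<Union>a\<in>C. U a)"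
    using compactE_image[OF assms(1), of A U] U(1) by blast
  define \<delta> where "\<delta> = Min ((\<lambda>a. f a (b a) / 2) ` C)"
  have "C \<noteq> {}" using C(3) assms(2) by blast
  show ?thesis
  proof (rule that[of "b ` C" \<delta>])
    show "0 < \<delta>" unfolding \<delta>_def using C \<open>C \<noteq> {}\<close> b(2) by (subst Min_gr_iff) auto
    fix x assume "x \<in> A"
    then obtain a where a: "a \<in> C" "x \<in> U a" using C(3) by blast
    then have "f a (b a) / 2 < f x (b a)" using U(2) C(1) \<open>x \<in> A\<close> by blast
    moreover have "\<delta> \<le> f a (b a) / 2" unfolding \<delta>_def using a C(2) by (intro Min_le) auto
    ultimately show "\<exists>b\<in>b ` C. \<delta> \<le> f x b" using a(1) by force
  qed (use C b \<open>C \<noteq> {}\<close> in auto)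
qed

text \<open>The null set may depend on \<open>b\<close>, so it is discarded only for a countable
  dense set of \<open>b\<close>. For a remaining \<open>a\<close>, the set where \<open>f a\<close>
  is positive is relatively open and misses a dense set, hence is empty.\<close>

lemma uniform_section_from_AE:
  fixes B :: "'b::polish_space set"
  assumes \<mu>: "prob_space \<mu>" and lsc: "\<And>a. a \<in> space \<mu> \<Longrightarrow> lsc_on B (f a)"
    and ae: "\<And>b. b \<in> B \<Longrightarrow> AE a in \<mu>. f a b \<le> (0::real)"
  obtains a where "a \<in> space \<mu>" "\<And>b. b \<in> B \<Longrightarrow> f a b \<le> 0"
proof -
  obtain T where T: "countable T" "T \<subseteq> B" "B \<subseteq> closure T" by (rule separable)
  have "AE a in \<mu>. \<forall>b\<in>T. f a b \<le> 0" using ae T by (subst AE_ball_countable) auto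
  then have "\<exists>a\<in>space \<mu>. \<forall>b\<in>T. f a b \<le> 0"
  proof (rule contrapos_pp)
    assume "\<not> (\<exists>a\<in>space \<mu>. \<forall>b\<in>T. f a b \<le> 0)"
    then have "AE a in \<mu>. \<not> (\<forall>b\<in>T. f a b \<le> 0)" by (intro AE_I2) blast
    then show "\<not> (AE a in \<mu>. \<forall>b\<in>T. f a b \<le> 0)" using prob_space.AE_contr[OF \<mu>] by blast
  qed
  then obtain a where a: "a \<in> space \<mu>" "\<forall>b\<in>T. f a b \<le> 0" by blast
  have "f a b \<le> 0" if b: "b \<in> B" for b
  proof (rule ccontr)
    assume "\<not> f a b \<le> 0"
    obtain U where U: "open U" "\<And>x. x \<in> B \<Longrightarrow> x \<in> U \<longleftrightarrow> 0 < f a x"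
      using lsc_on_open_trace[OF lsc[OF a(1)]] by blast
    have "b \<in> U" using U(2) b \<open>\<not> f a b \<le> 0\<close> by simp
    then have "U \<inter> T \<noteq> {}"
      using U(1) T(3) b open_Int_closure_eq_empty[of U T] by blast
    then show False using U(2) a(2) T(2) by fastforce
  qed
  then show ?thesis using a(1) that by blast
qed

section \<open>Uniform measures on finite sets of actions\<close>

text \<open>Pushed forward along the identity, so that it carries the Borel sets of \<open>X\<close>
  and belongs to \<open>borel_probs X\<close>. For a singleton it is the point mass, that is, a pure
  action.\<close>

definition uniform_on :: "'x::polish_space set \<Rightarrow> 'x set \<Rightarrow> 'x measure" where
  "uniform_on X S = distr (uniform_count_measure S) (restrict_space borel X) (\<lambda>x. x)"

context
  fixes X S :: "'x::polish_space set"
  assumes S: "finite S" "S \<noteq> {}" "S \<subseteq> X"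
begin

lemma measurable_uniform_on: "(\<lambda>x. x) \<in> uniform_count_measure S \<rightarrow>\<^sub>M restrict_space borel X"
  using S(3) by (auto simp: measurable_def space_uniform_count_measure sets_uniform_count_measure
      space_restrict_space)

lemma uniform_on_borel_probs: "uniform_on X S \<in> borel_probs X"
  using prob_space.prob_space_distr[OF prob_space_uniform_count_measure[OF S(1,2)] measurable_uniform_on]
  by (simp add: borel_probs_def space_prob_algebra uniform_on_def)

lemma sets_restrict_borel_finite: "S \<in> sets (restrict_space borel X)"
  using S by (auto simp: sets_restrict_space intro!: image_eqI[of _ _ S] borel_closed finite_imp_closed)

lemma AE_uniform_on: "AE x in uniform_on X S. x \<in> S"
  unfolding uniform_on_def
proof (subst AE_distr_iff[OF measurable_uniform_on])
  have "{x \<in> space (restrict_space borel X). x \<in> S} = S" using S by (auto simp: space_restrict_space)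
  then show "{x \<in> space (restrict_space borel X). x \<in> S} \<in> sets (restrict_space borel X)"
    using sets_restrict_borel_finite by simp
qed (auto intro!: AE_I2 simp: space_uniform_count_measure)

lemma integral_uniform_on:
  fixes f :: "'x \<Rightarrow> real"
  assumes "f \<in> borel_measurable (restrict_space borel X)"
  shows "(\<integral>x. f x \<partial>uniform_on X S) = (\<Sum>x\<in>S. f x) / card S"
  unfolding uniform_on_def
  by (subst integral_distr[OF measurable_uniform_on assms])
    (simp add: uniform_count_measure_def lebesgue_integral_point_measure_finite S sum_divide_distrib)

text \<open>One term of the average is at least \<open>\<delta>\<close> and the others are
  nonnegative.\<close>

lemma integral_uniform_on_ge:
  fixes f :: "'x \<Rightarrow> real"
  assumes "f \<in> borel_measurable (restrict_space borel X)" "\<And>x. x \<in> S \<Longrightarrow> 0 \<le> f x" "\<exists>x\<in>S. \<delta> \<le> f x"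
  shows "\<delta> / card S \<le> (\<integral>x. f x \<partial>uniform_on X S)"
proof -
  obtain x where x: "x \<in> S" "\<delta> \<le> f x" using assms(3) by blast
  have "f x \<le> (\<Sum>x\<in>S. f x)" using x S assms(2) by (intro member_le_sum) auto
  then show ?thesis unfolding integral_uniform_on[OF assms(1)] using x by (auto intro!: divide_right_mono)
qed

end

text \<open>The singleton has full measure, so \<open>P x\<close> may be replaced by the constant
  statement \<open>P a\<close>, which holds almost surely only if it is true.\<close>

lemma AE_uniform_on_single:
  fixes X :: "'x::polish_space set"
  assumes "a \<in> X" "AE x in uniform_on X {a}. P x"
  shows "P a"
proof -
  have "AE x in uniform_on X {a}. x \<in> {a}" using assms(1) by (intro AE_uniform_on) auto
  with assms(2) have "AE x in uniform_on X {a}. P a" by eventually_elim simp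
  moreover have "prob_space (uniform_on X {a})"
    using assms(1) by (intro borel_probsD(1)[OF uniform_on_borel_probs]) auto
  ultimately show ?thesis by (simp add: prob_space.AE_const)
qed

lemma AE_pair_fst:
  assumes "prob_space \<mu>" "prob_space \<nu>" "S \<in> sets \<mu>" "AE a in \<mu>. a \<in> S"
  shows "AE p in \<mu> \<Otimes>\<^sub>M \<nu>. fst p \<in> S"
proof -
  interpret \<mu>: prob_space \<mu> by fact
  interpret \<nu>: prob_space \<nu> by fact
  interpret pair_sigma_finite \<mu> \<nu> ..
  show ?thesis
  proof (rule AE_pair_measure)
    have "{p \<in> space (\<mu> \<Otimes>\<^sub>M \<nu>). fst p \<in> S} = fst -` S \<inter> space (\<mu> \<Otimes>\<^sub>M \<nu>)" by auto
    then show "{p \<in> space (\<mu> \<Otimes>\<^sub>M \<nu>). fst p \<in> S} \<in> sets (\<mu> \<Otimes>\<^sub>M \<nu>)"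
      using measurable_sets[OF measurable_fst assms(3)] by simp
  qed (use assms(4) in simp)
qed

lemma AE_pair_snd:
  assumes "prob_space \<mu>" "prob_space \<nu>" "S \<in> sets \<nu>" "AE b in \<nu>. b \<in> S"
  shows "AE p in \<mu> \<Otimes>\<^sub>M \<nu>. snd p \<in> S"
proof -
  interpret \<mu>: prob_space \<mu> by fact
  interpret \<nu>: prob_space \<nu> by fact
  interpret pair_sigma_finite \<mu> \<nu> ..
  show ?thesis
  proof (rule AE_pair_measure)
    have "{p \<in> space (\<mu> \<Otimes>\<^sub>M \<nu>). snd p \<in> S} = snd -` S \<inter> space (\<mu> \<Otimes>\<^sub>M \<nu>)" by auto
    then show "{p \<in> space (\<mu> \<Otimes>\<^sub>M \<nu>). snd p \<in> S} \<in> sets (\<mu> \<Otimes>\<^sub>M \<nu>)"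
      using measurable_sets[OF measurable_snd assms(3)] by simp
  qed (use assms(4) in simp)
qed

section \<open>Dominions and pure actions\<close>

locale compact_game =
  fixes \<Gamma> :: "('n::finite, 'a::polish_space, 'b::polish_space) stochastic_game"
  assumes game: "is_stochastic_game \<Gamma>"
    and max_compact: "\<And>i. max_avail \<Gamma> i \<noteq> {} \<and> compact (max_avail \<Gamma> i)"
    and min_compact: "\<And>i. min_avail \<Gamma> i \<noteq> {} \<and> compact (min_avail \<Gamma> i)"
    and payoff_usc: "\<And>i b. b \<in> min_avail \<Gamma> i \<Longrightarrow>
      usc_on (max_avail \<Gamma> i) (\<lambda>a. payoff \<Gamma> (i, a, b))"
    and trans_usc: "\<And>i b j. b \<in> min_avail \<Gamma> i \<Longrightarrow>
      usc_on (max_avail \<Gamma> i) (\<lambda>a. trans_prob \<Gamma> j (i, a, b))"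
    and payoff_lsc: "\<And>i a. a \<in> max_avail \<Gamma> i \<Longrightarrow>
      lsc_on (min_avail \<Gamma> i) (\<lambda>b. payoff \<Gamma> (i, a, b))"
    and trans_lsc: "\<And>i a j. a \<in> max_avail \<Gamma> i \<Longrightarrow>
      lsc_on (min_avail \<Gamma> i) (\<lambda>b. trans_prob \<Gamma> j (i, a, b))"
begin

lemma feasible_iff: "(i, a, b) \<in> feasible \<Gamma> \<longleftrightarrow> a \<in> max_avail \<Gamma> i \<and> b \<in> min_avail \<Gamma> i"
  by (simp add: feasible_def)

lemma exit_prob_sum:
  assumes "k \<in> feasible \<Gamma>"
  shows "exit_prob \<Gamma> D k = (\<Sum>l\<in>- D. trans_prob \<Gamma> l k)"
proof -
  interpret prob_space "trans_law \<Gamma> k" by (rule trans_law_props(1)[OF game assms])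
  show ?thesis
    unfolding exit_prob_def trans_prob_def
    by (rule finite_measure_eq_sum_singleton) (auto simp: trans_law_props[OF game assms])
qed

lemma sum_trans_prob: "k \<in> feasible \<Gamma> \<Longrightarrow> (\<Sum>l\<in>UNIV. trans_prob \<Gamma> l k) = 1"
  using exit_prob_sum[of k "{}"] prob_space.prob_space[OF trans_law_props(1)[OF game]]
    trans_law_props(3)[OF game] by (simp add: exit_prob_def)

lemma trans_prob_nonneg: "0 \<le> trans_prob \<Gamma> l k"
  by (simp add: trans_prob_def)

text \<open>The negated form suits Max: upper semicontinuity of the transition probabilities in
  Max's action becomes lower semicontinuity of the summands.\<close>

lemma exit_prob_compl:
  assumes "k \<in> feasible \<Gamma>"
  shows "exit_prob \<Gamma> D k = 1 + (\<Sum>l\<in>D. - trans_prob \<Gamma> l k)"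
proof -
  have "(\<Sum>l\<in>UNIV. trans_prob \<Gamma> l k) = (\<Sum>l\<in>D. trans_prob \<Gamma> l k) + (\<Sum>l\<in>- D. trans_prob \<Gamma> l k)"
    by (subst sum.union_disjoint[symmetric]) (auto intro!: sum.cong)
  then show ?thesis using exit_prob_sum[OF assms] sum_trans_prob[OF assms] by (simp add: sum_negf)
qed

lemma exit_prob_le_1: "k \<in> feasible \<Gamma> \<Longrightarrow> exit_prob \<Gamma> D k \<le> 1"
  using prob_space.prob_le_1[OF trans_law_props(1)[OF game]] by (simp add: exit_prob_def)

lemma exit_prob_lsc_min:
  assumes "a \<in> max_avail \<Gamma> i"
  shows "lsc_on (min_avail \<Gamma> i) (\<lambda>b. exit_prob \<Gamma> D (i, a, b))"
proof -
  have "lsc_on (min_avail \<Gamma> i) (\<lambda>b. \<Sum>l\<in>- D. trans_prob \<Gamma> l (i, a, b))"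
    by (intro lsc_on_sum trans_lsc assms)
  moreover have "{b \<in> min_avail \<Gamma> i. c < exit_prob \<Gamma> D (i, a, b)} =
      {b \<in> min_avail \<Gamma> i. c < (\<Sum>l\<in>- D. trans_prob \<Gamma> l (i, a, b))}" for c
    using assms by (auto simp: exit_prob_sum feasible_iff)
  ultimately show ?thesis by (simp add: lsc_on_def)
qed

text \<open>Upper semicontinuity of every \<open>p(l | i, \<cdot>, b)\<close> makes each of them also lower semicontinuous,
  because they sum to 1.\<close>

lemma exit_prob_lsc_max:
  assumes "b \<in> min_avail \<Gamma> i"
  shows "lsc_on (max_avail \<Gamma> i) (\<lambda>a. exit_prob \<Gamma> D (i, a, b))"
proof -
  have "lsc_on (max_avail \<Gamma> i) (\<lambda>a. 1 + (\<Sum>l\<in>D. - trans_prob \<Gamma> l (i, a, b)))"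
    using trans_usc[OF assms] by (intro lsc_on_add lsc_on_const lsc_on_sum) (simp add: lsc_on_uminus)
  moreover have "{a \<in> max_avail \<Gamma> i. c < exit_prob \<Gamma> D (i, a, b)} =
      {a \<in> max_avail \<Gamma> i. c < 1 + (\<Sum>l\<in>D. - trans_prob \<Gamma> l (i, a, b))}" for c
    using assms by (auto simp only: exit_prob_compl feasible_iff)
  ultimately show ?thesis by (simp add: lsc_on_def)
qed

lemma pure_max_strategy:
  assumes "\<And>j. f j \<in> max_avail \<Gamma> j"
  shows "max_strategy \<Gamma> (\<lambda>m (\<omega>, j). uniform_on (max_avail \<Gamma> j) {f j})"
  unfolding max_strategy_def
  using uniform_on_borel_probs[of "{f _}"] assms by (auto simp: borel_probs_def)

lemma pure_min_strategy:
  assumes "\<And>j. f j \<in> min_avail \<Gamma> j"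
  shows "min_strategy \<Gamma> (\<lambda>m (\<omega>, j). uniform_on (min_avail \<Gamma> j) {f j})"
  unfolding min_strategy_def
  using uniform_on_borel_probs[of "{f _}"] assms by (auto simp: borel_probs_def)

text \<open>If a mixed action keeps the play in \<open>D\<close> against every opposing action, then almost every
  action in its support does so against a countable dense set of opposing actions, hence, by
  semicontinuity, against all of them. So pure actions suffice.\<close>

lemma max_dominion_iff:
  "max_dominion \<Gamma> D \<longleftrightarrow> D \<noteq> {} \<and>
    (\<forall>i\<in>D. \<exists>a\<in>max_avail \<Gamma> i. \<forall>b\<in>min_avail \<Gamma> i. exit_prob \<Gamma> D (i, a, b) = 0)"
proof (intro iffI conjI ballI)
  assume dom: "max_dominion \<Gamma> D"
  then show "D \<noteq> {}" by (simp add: max_dominion_def)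
  fix i assume i: "i \<in> D"
  obtain \<sigma> where \<sigma>: "max_strategy \<Gamma> \<sigma>"
    and conf: "\<And>\<tau>. min_strategy \<Gamma> \<tau> \<Longrightarrow> AE \<omega> in play_law \<Gamma> \<sigma> \<tau> i. \<forall>m. fst (\<omega> m) \<in> D"
    using dom i unfolding max_dominion_def by blast
  let ?\<mu> = "\<sigma> 0 (\<lambda>_. undefined, i)"
  have "?\<mu> \<in> borel_probs (max_avail \<Gamma> i)"
    by (rule max_strategy_props[OF \<sigma>]) (simp add: space_PiM)
  note \<mu> = borel_probsD[OF this]
  have "AE a in ?\<mu>. exit_prob \<Gamma> D (i, a, b) \<le> 0" if b: "b \<in> min_avail \<Gamma> i" for b
  proof -
    \<comment> \<open>Min answers with a stationary pure strategy that plays \<open>b\<close> in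
      state \<open>i\<close>; elsewhere any available action completes it.\<close>
    define f where "f j = (if j = i then b else SOME b. b \<in> min_avail \<Gamma> j)" for j
    have f: "f j \<in> min_avail \<Gamma> j" for j
      using b min_compact by (auto simp: f_def some_in_eq)
    have fi: "f i = b" by (simp add: f_def)
    let ?\<nu> = "uniform_on (min_avail \<Gamma> i) {b}"
    have \<nu>: "prob_space ?\<nu>" using b by (intro borel_probsD(1)[OF uniform_on_borel_probs]) auto
    interpret \<mu>: prob_space ?\<mu> by (rule \<mu>(1))
    interpret \<nu>: prob_space ?\<nu> by (rule \<nu>)
    interpret pair_sigma_finite ?\<mu> ?\<nu> ..
    have "AE p in ?\<mu> \<Otimes>\<^sub>M ?\<nu>. exit_prob \<Gamma> D (i, p) = 0"
      using AE_first_move_confined[OF game \<sigma> pure_min_strategy[OF f] conf[OF pure_min_strategy[OF f]]]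
      unfolding case_prod_conv by (simp only: fi)
    \<comment> \<open>Splitting the product leaves, for almost every \<open>a\<close>, a statement
      about the point mass at \<open>b\<close>.\<close>
    from AE_pair[OF this] show ?thesis
      by (rule AE_mp) (auto intro!: AE_I2 dest: AE_uniform_on_single[OF b])
  qed
  then obtain a where "a \<in> max_avail \<Gamma> i" "\<And>b. b \<in> min_avail \<Gamma> i \<Longrightarrow> exit_prob \<Gamma> D (i, a, b) \<le> 0"
    using uniform_section_from_AE[of ?\<mu> "min_avail \<Gamma> i" "\<lambda>a b. exit_prob \<Gamma> D (i, a, b)"] \<mu>
      exit_prob_lsc_min by metis
  then show "\<exists>a\<in>max_avail \<Gamma> i. \<forall>b\<in>min_avail \<Gamma> i. exit_prob \<Gamma> D (i, a, b) = 0"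
    using exit_prob_nonneg[of \<Gamma> D] by (auto intro!: bexI[of _ a] antisym)
next
  assume R: "D \<noteq> {} \<and>
    (\<forall>i\<in>D. \<exists>a\<in>max_avail \<Gamma> i. \<forall>b\<in>min_avail \<Gamma> i. exit_prob \<Gamma> D (i, a, b) = 0)"
  \<comment> \<open>A strategy must be defined in every state, so the choice is extended outside
    \<open>D\<close> by arbitrary available actions.\<close>
  have "\<forall>i. \<exists>a\<in>max_avail \<Gamma> i. i \<in> D \<longrightarrow> (\<forall>b\<in>min_avail \<Gamma> i. exit_prob \<Gamma> D (i, a, b) = 0)"
    using R max_compact by blast
  then obtain f where f: "\<And>i. f i \<in> max_avail \<Gamma> i"
    "\<And>i b. i \<in> D \<Longrightarrow> b \<in> min_avail \<Gamma> i \<Longrightarrow> exit_prob \<Gamma> D (i, f i, b) = 0" by metis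
  let ?\<sigma> = "\<lambda>m (\<omega>, j). uniform_on (max_avail \<Gamma> j) {f j}"
  have "AE \<omega> in play_law \<Gamma> ?\<sigma> \<tau> i. \<forall>m. fst (\<omega> m) \<in> D" if i: "i \<in> D" and \<tau>: "min_strategy \<Gamma> \<tau>" for i \<tau>
  proof (rule AE_confined_if_moves_confined[OF game pure_max_strategy[OF f(1)] \<tau> i])
    fix m :: nat and \<omega> j assume \<omega>: "\<omega> \<in> space (\<Pi>\<^sub>M t\<in>{0..<m}. K_space \<Gamma>)" and j: "j \<in> D"
    let ?\<mu> = "uniform_on (max_avail \<Gamma> j) {f j}"
    note \<nu> = borel_probsD[OF min_strategy_props[OF \<tau> \<omega>], of j]
    have "?\<mu> \<in> borel_probs (max_avail \<Gamma> j)" using f(1) by (intro uniform_on_borel_probs) auto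
    note \<mu> = borel_probsD[OF this]
    have "AE p in ?\<mu> \<Otimes>\<^sub>M \<tau> m (\<omega>, j). fst p \<in> {f j}"
      using f(1)[of j] by (intro AE_pair_fst \<mu>(1) \<nu>(1) AE_uniform_on)
        (auto simp: \<mu>(2) intro!: sets_restrict_borel_finite)
    then have "AE p in ?\<mu> \<Otimes>\<^sub>M \<tau> m (\<omega>, j). exit_prob \<Gamma> D (j, p) = 0"
      by (rule AE_mp) (auto intro!: AE_I2 simp: space_pair_measure \<nu>(3) f(2)[OF j])
    then show "AE p in ?\<sigma> m (\<omega>, j) \<Otimes>\<^sub>M \<tau> m (\<omega>, j). exit_prob \<Gamma> D (j, p) = 0"
      unfolding case_prod_conv .
  qed
  then show "max_dominion \<Gamma> D"
    unfolding max_dominion_def using R pure_max_strategy[OF f(1)] by blast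
qed

text \<open>Mirror image of \<open>max_dominion_iff\<close>: a pure action is extracted from Min's
  mixed action by lower semicontinuity of the exit probability in Max's action.\<close>

lemma min_dominion_iff:
  "min_dominion \<Gamma> D \<longleftrightarrow> D \<noteq> {} \<and>
    (\<forall>i\<in>D. \<exists>b\<in>min_avail \<Gamma> i. \<forall>a\<in>max_avail \<Gamma> i. exit_prob \<Gamma> D (i, a, b) = 0)"
proof (intro iffI conjI ballI)
  assume dom: "min_dominion \<Gamma> D"
  then show "D \<noteq> {}" by (simp add: min_dominion_def)
  fix i assume i: "i \<in> D"
  obtain \<tau> where \<tau>: "min_strategy \<Gamma> \<tau>"
    and conf: "\<And>\<sigma>. max_strategy \<Gamma> \<sigma> \<Longrightarrow> AE \<omega> in play_law \<Gamma> \<sigma> \<tau> i. \<forall>m. fst (\<omega> m) \<in> D"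
    using dom i unfolding min_dominion_def by blast
  let ?\<nu> = "\<tau> 0 (\<lambda>_. undefined, i)"
  have "?\<nu> \<in> borel_probs (min_avail \<Gamma> i)"
    by (rule min_strategy_props[OF \<tau>]) (simp add: space_PiM)
  note \<nu> = borel_probsD[OF this]
  have "AE b in ?\<nu>. exit_prob \<Gamma> D (i, a, b) \<le> 0" if a: "a \<in> max_avail \<Gamma> i" for a
  proof -
    define f where "f j = (if j = i then a else SOME a. a \<in> max_avail \<Gamma> j)" for j
    have f: "f j \<in> max_avail \<Gamma> j" for j
      using a max_compact by (auto simp: f_def some_in_eq)
    have fi: "f i = a" by (simp add: f_def)
    let ?\<mu> = "uniform_on (max_avail \<Gamma> i) {a}"
    have \<mu>: "prob_space ?\<mu>" using a by (intro borel_probsD(1)[OF uniform_on_borel_probs]) auto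
    interpret \<mu>: prob_space ?\<mu> by (rule \<mu>)
    interpret \<nu>: prob_space ?\<nu> by (rule \<nu>(1))
    interpret pair_sigma_finite ?\<mu> ?\<nu> ..
    have "AE p in ?\<mu> \<Otimes>\<^sub>M ?\<nu>. exit_prob \<Gamma> D (i, p) = 0"
      using AE_first_move_confined[OF game pure_max_strategy[OF f] \<tau> conf[OF pure_max_strategy[OF f]]]
      unfolding case_prod_conv by (simp only: fi)
    \<comment> \<open>Here the point mass is the first factor of the product, so it is removed from
      the outer quantifier.\<close>
    from AE_uniform_on_single[OF a AE_pair[OF this]] show ?thesis by eventually_elim simp
  qed
  then obtain b where "b \<in> min_avail \<Gamma> i" "\<And>a. a \<in> max_avail \<Gamma> i \<Longrightarrow> exit_prob \<Gamma> D (i, a, b) \<le> 0"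
    using uniform_section_from_AE[of ?\<nu> "max_avail \<Gamma> i" "\<lambda>b a. exit_prob \<Gamma> D (i, a, b)"] \<nu>
      exit_prob_lsc_max by metis
  then show "\<exists>b\<in>min_avail \<Gamma> i. \<forall>a\<in>max_avail \<Gamma> i. exit_prob \<Gamma> D (i, a, b) = 0"
    using exit_prob_nonneg[of \<Gamma> D] by (auto intro!: bexI[of _ b] antisym)
next
  assume R: "D \<noteq> {} \<and>
    (\<forall>i\<in>D. \<exists>b\<in>min_avail \<Gamma> i. \<forall>a\<in>max_avail \<Gamma> i. exit_prob \<Gamma> D (i, a, b) = 0)"
  have "\<forall>i. \<exists>b\<in>min_avail \<Gamma> i. i \<in> D \<longrightarrow> (\<forall>a\<in>max_avail \<Gamma> i. exit_prob \<Gamma> D (i, a, b) = 0)"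
    using R min_compact by blast
  then obtain f where f: "\<And>i. f i \<in> min_avail \<Gamma> i"
    "\<And>i a. i \<in> D \<Longrightarrow> a \<in> max_avail \<Gamma> i \<Longrightarrow> exit_prob \<Gamma> D (i, a, f i) = 0" by metis
  let ?\<tau> = "\<lambda>m (\<omega>, j). uniform_on (min_avail \<Gamma> j) {f j}"
  have "AE \<omega> in play_law \<Gamma> \<sigma> ?\<tau> i. \<forall>m. fst (\<omega> m) \<in> D" if i: "i \<in> D" and \<sigma>: "max_strategy \<Gamma> \<sigma>" for i \<sigma>
  proof (rule AE_confined_if_moves_confined[OF game \<sigma> pure_min_strategy[OF f(1)] i])
    fix m :: nat and \<omega> j assume \<omega>: "\<omega> \<in> space (\<Pi>\<^sub>M t\<in>{0..<m}. K_space \<Gamma>)" and j: "j \<in> D"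
    let ?\<nu> = "uniform_on (min_avail \<Gamma> j) {f j}"
    note \<mu> = borel_probsD[OF max_strategy_props[OF \<sigma> \<omega>], of j]
    have "?\<nu> \<in> borel_probs (min_avail \<Gamma> j)" using f(1) by (intro uniform_on_borel_probs) auto
    note \<nu> = borel_probsD[OF this]
    have "AE p in \<sigma> m (\<omega>, j) \<Otimes>\<^sub>M ?\<nu>. snd p \<in> {f j}"
      using f(1)[of j] by (intro AE_pair_snd \<mu>(1) \<nu>(1) AE_uniform_on)
        (auto simp: \<nu>(2) intro!: sets_restrict_borel_finite)
    then have "AE p in \<sigma> m (\<omega>, j) \<Otimes>\<^sub>M ?\<nu>. exit_prob \<Gamma> D (j, p) = 0"
      by (rule AE_mp) (auto intro!: AE_I2 simp: space_pair_measure \<mu>(3) f(2)[OF j])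
    then show "AE p in \<sigma> m (\<omega>, j) \<Otimes>\<^sub>M ?\<tau> m (\<omega>, j). exit_prob \<Gamma> D (j, p) = 0"
      unfolding case_prod_conv .
  qed
  then show "min_dominion \<Gamma> D"
    unfolding min_dominion_def using R pure_min_strategy[OF f(1)] by blast
qed

end

section \<open>The Shapley operator\<close>

text \<open>The positive part integrates to at most \<open>C\<close>, and subtracting the integral
  of the negative part only lowers the value; a finite minuend excludes an indeterminate difference.
  The condition \<open>0 \<le> C\<close> matches the truncation of negative numbers by
  \<open>ennreal\<close>.\<close>

lemma quasi_integral_le:
  assumes "prob_space M" "0 \<le> C" "AE x in M. f x \<le> ereal C"
  shows "quasi_integral M f \<le> ereal C"
proof -
  interpret prob_space M by fact
  have "(\<integral>\<^sup>+ x. e2ennreal (f x) \<partial>M) \<le> (\<integral>\<^sup>+ x. ennreal C \<partial>M)"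
    using assms(3) by (intro nn_integral_mono_AE) (auto elim!: eventually_mono dest: e2ennreal_mono)
  also have "\<dots> = ennreal C" by (simp add: emeasure_space_1)
  finally have "enn2ereal (\<integral>\<^sup>+ x. e2ennreal (f x) \<partial>M) \<le> ereal C"
    using assms(2) by (metis enn2ereal_ennreal less_eq_ennreal.rep_eq)
  moreover have "a - enn2ereal b \<le> ereal C" if "a \<le> ereal C" for a b
    using that enn2ereal_nonneg[of b] by (cases a; cases "enn2ereal b") auto
  ultimately show ?thesis unfolding quasi_integral_def by blast
qed

text \<open>Dually, the negative part integrates to at most \<open>C\<close>, so the subtrahend is
  finite.\<close>

lemma quasi_integral_ge:
  assumes "prob_space M" "0 \<le> C" "AE x in M. ereal (- C) \<le> f x"
  shows "ereal (- C) \<le> quasi_integral M f"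
proof -
  interpret prob_space M by fact
  have "(\<integral>\<^sup>+ x. e2ennreal (- f x) \<partial>M) \<le> (\<integral>\<^sup>+ x. ennreal C \<partial>M)"
  proof (intro nn_integral_mono_AE)
    show "AE x in M. e2ennreal (- f x) \<le> ennreal C"
      using assms(3)
    proof eventually_elim
      case (elim x)
      then have "- f x \<le> ereal C" by (simp add: ereal_uminus_le_reorder)
      then show ?case using e2ennreal_mono by fastforce
    qed
  qed
  also have "\<dots> = ennreal C" by (simp add: emeasure_space_1)
  finally have "enn2ereal (\<integral>\<^sup>+ x. e2ennreal (- f x) \<partial>M) \<le> ereal C"
    using assms(2) by (metis enn2ereal_ennreal less_eq_ennreal.rep_eq)
  moreover have "ereal (- C) \<le> enn2ereal a - b" if "b \<le> ereal C" for a b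
    using that enn2ereal_nonneg[of a] by (cases b; cases "enn2ereal a") auto
  ultimately show ?thesis unfolding quasi_integral_def by blast
qed

lemma quasi_integral_integrable:
  assumes "integrable M f"
  shows "quasi_integral M (\<lambda>x. ereal (f x)) = ereal (\<integral>x. f x \<partial>M)"
proof -
  have "(\<integral>\<^sup>+ x. ennreal (f x) \<partial>M) < \<infinity>" "(\<integral>\<^sup>+ x. ennreal (- f x) \<partial>M) < \<infinity>"
    using assms by (auto simp: real_integrable_def less_top)
  then have "enn2ereal (\<integral>\<^sup>+ x. ennreal (f x) \<partial>M) = ereal (enn2real (\<integral>\<^sup>+ x. ennreal (f x) \<partial>M))"
    "enn2ereal (\<integral>\<^sup>+ x. ennreal (- f x) \<partial>M) = ereal (enn2real (\<integral>\<^sup>+ x. ennreal (- f x) \<partial>M))"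
    by (auto simp: less_top[symmetric] enn2ereal_ennreal[symmetric] ennreal_enn2real)
  then show ?thesis
    unfolding quasi_integral_def real_lebesgue_integral_def[OF assms] by simp
qed

context compact_game
begin

abbreviation max_mixed :: "'n \<Rightarrow> 'a measure set" where "max_mixed i \<equiv> borel_probs (max_avail \<Gamma> i)"
abbreviation min_mixed :: "'n \<Rightarrow> 'b measure set" where "min_mixed i \<equiv> borel_probs (min_avail \<Gamma> i)"

lemma integrable_exit_prob:
  assumes "\<mu> \<in> max_mixed i" "\<nu> \<in> min_mixed i"
  shows "integrable (\<mu> \<Otimes>\<^sub>M \<nu>) (\<lambda>p. exit_prob \<Gamma> D (i, p))"
proof -
  note \<mu> = borel_probsD[OF assms(1)] and \<nu> = borel_probsD[OF assms(2)]
  interpret prob_space "\<mu> \<Otimes>\<^sub>M \<nu>" using \<mu>(1) \<nu>(1) by (rule prob_space_pair)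
  show ?thesis
  proof (rule integrable_const_bound)
    show "AE p in \<mu> \<Otimes>\<^sub>M \<nu>. norm (exit_prob \<Gamma> D (i, p)) \<le> 1"
      by (intro AE_I2)
        (auto simp: space_pair_measure \<mu>(3) \<nu>(3) exit_prob_nonneg feasible_iff intro!: exit_prob_le_1)
    have "(\<lambda>p. (i, p)) \<in> \<mu> \<Otimes>\<^sub>M \<nu> \<rightarrow>\<^sub>M K_space \<Gamma>"
      unfolding measurable_cong_sets[OF sets_pair_measure_cong[OF \<mu>(2) \<nu>(2)] refl]
      by (rule measurable_feasible_embed)
    from measurable_compose[OF this measurable_exit_prob[OF game]]
    show "(\<lambda>p. exit_prob \<Gamma> D (i, p)) \<in> borel_measurable (\<mu> \<Otimes>\<^sub>M \<nu>)" .
  qed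
qed

lemma trans_prob_exit: "trans_prob \<Gamma> l = exit_prob \<Gamma> (- {l})"
  by (simp add: trans_prob_def[abs_def] exit_prob_def[abs_def])

text \<open>Boundedness turns both quasi-integrals into ordinary integrals, which Fubini's theorem
  merges over the product measure.\<close>

lemma mixed_ext_trans_prob:
  assumes "\<mu> \<in> max_mixed i" "\<nu> \<in> min_mixed i"
  shows "mixed_ext (trans_prob \<Gamma> l) i \<mu> \<nu> = ereal (\<integral>p. trans_prob \<Gamma> l (i, p) \<partial>(\<mu> \<Otimes>\<^sub>M \<nu>))"
proof -
  note \<mu> = borel_probsD[OF assms(1)] and \<nu> = borel_probsD[OF assms(2)]
  interpret \<mu>: prob_space \<mu> by (rule \<mu>(1))
  interpret \<nu>: prob_space \<nu> by (rule \<nu>(1))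
  interpret pair_sigma_finite \<mu> \<nu> ..
  have int: "integrable (\<mu> \<Otimes>\<^sub>M \<nu>) (\<lambda>(a, b). trans_prob \<Gamma> l (i, a, b))"
    using integrable_exit_prob[OF assms, of "- {l}"] by (simp add: trans_prob_exit case_prod_beta')
  have meas: "(\<lambda>p. trans_prob \<Gamma> l (i, p)) \<in> borel_measurable (\<mu> \<Otimes>\<^sub>M \<nu>)"
    using borel_measurable_integrable[OF int] by (simp add: case_prod_beta')
  have inner: "quasi_integral \<nu> (\<lambda>b. ereal (trans_prob \<Gamma> l (i, a, b))) =
      ereal (\<integral>b. trans_prob \<Gamma> l (i, a, b) \<partial>\<nu>)" if a: "a \<in> space \<mu>" for a
  proof (rule quasi_integral_integrable, rule \<nu>.integrable_const_bound)
    show "AE b in \<nu>. norm (trans_prob \<Gamma> l (i, a, b)) \<le> 1"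
      using a by (intro AE_I2) (auto simp: \<mu>(3) \<nu>(3) trans_prob_exit exit_prob_nonneg feasible_iff
          intro!: exit_prob_le_1)
    show "(\<lambda>b. trans_prob \<Gamma> l (i, a, b)) \<in> borel_measurable \<nu>"
      using measurable_compose[OF measurable_Pair1'[OF a] meas] .
  qed
  have "mixed_ext (trans_prob \<Gamma> l) i \<mu> \<nu> = quasi_integral \<mu> (\<lambda>a. ereal (\<integral>b. trans_prob \<Gamma> l (i, a, b) \<partial>\<nu>))"
    unfolding mixed_ext_def quasi_integral_def[of \<mu>]
    by (intro arg_cong2[where f = "(-)"] arg_cong[where f = enn2ereal] nn_integral_cong) (simp_all add: inner)
  also have "\<dots> = ereal (\<integral>a. \<integral>b. trans_prob \<Gamma> l (i, a, b) \<partial>\<nu> \<partial>\<mu>)"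
    using integrable_fst[OF int] by (rule quasi_integral_integrable)
  also have "\<dots> = ereal (\<integral>p. trans_prob \<Gamma> l (i, p) \<partial>(\<mu> \<Otimes>\<^sub>M \<nu>))"
    using integral_fst[OF int] by (simp add: case_prod_beta')
  finally show ?thesis .
qed

section \<open>Continuation values and bounds on the one-stage value\<close>

text \<open>The expected continuation value, kept as a real integral so that only the payoff term
  can be infinite.\<close>

definition next_mean :: "real ^ 'n \<Rightarrow> 'n \<Rightarrow> 'a measure \<Rightarrow> 'b measure \<Rightarrow> real" where
  "next_mean x i \<mu> \<nu> = (\<integral>p. (\<Sum>l\<in>UNIV. x $ l * trans_prob \<Gamma> l (i, p)) \<partial>(\<mu> \<Otimes>\<^sub>M \<nu>))"

text \<open>The sup-inf inside \<open>shapley\<close> before conversion to a real, where suprema and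
  infima compare without side conditions.\<close>

definition stage_value :: "real ^ 'n \<Rightarrow> 'n \<Rightarrow> ereal" where
  "stage_value x i = (SUP \<mu>\<in>max_mixed i. INF \<nu>\<in>min_mixed i.
     mixed_ext (payoff \<Gamma>) i \<mu> \<nu> + ereal (next_mean x i \<mu> \<nu>))"

lemma integrable_next_mean:
  assumes "\<mu> \<in> max_mixed i" "\<nu> \<in> min_mixed i"
  shows "integrable (\<mu> \<Otimes>\<^sub>M \<nu>) (\<lambda>p. \<Sum>l\<in>UNIV. x $ l * trans_prob \<Gamma> l (i, p))"
  using integrable_exit_prob[OF assms] by (simp add: trans_prob_exit)

lemma shapley_eq: "shapley \<Gamma> x $ i = real_of_ereal (stage_value x i)"
proof -
  have "(\<Sum>l\<in>UNIV. ereal (x $ l) * mixed_ext (trans_prob \<Gamma> l) i \<mu> \<nu>) = ereal (next_mean x i \<mu> \<nu>)"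
    if "\<mu> \<in> max_mixed i" "\<nu> \<in> min_mixed i" for \<mu> \<nu>
  proof -
    have "next_mean x i \<mu> \<nu> = (\<Sum>l\<in>UNIV. x $ l * (\<integral>p. trans_prob \<Gamma> l (i, p) \<partial>(\<mu> \<Otimes>\<^sub>M \<nu>)))"
      unfolding next_mean_def using integrable_exit_prob[OF that]
      by (subst Bochner_Integration.integral_sum) (auto simp: trans_prob_exit)
    then show ?thesis by (simp add: mixed_ext_trans_prob[OF that])
  qed
  then show ?thesis unfolding shapley_def stage_value_def by (simp cong: INF_cong SUP_cong)
qed

lemma mixed_prob_space:
  "\<mu> \<in> max_mixed i \<Longrightarrow> \<nu> \<in> min_mixed i \<Longrightarrow> prob_space (\<mu> \<Otimes>\<^sub>M \<nu>)"
  by (intro prob_space_pair borel_probsD(1))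

lemma next_mean_mono:
  assumes \<mu>: "\<mu> \<in> max_mixed i" and \<nu>: "\<nu> \<in> min_mixed i" and le: "\<And>l. x $ l \<le> y $ l + c"
  shows "next_mean x i \<mu> \<nu> \<le> next_mean y i \<mu> \<nu> + c"
proof -
  interpret prob_space "\<mu> \<Otimes>\<^sub>M \<nu>" using \<mu> \<nu> by (rule mixed_prob_space)
  have "next_mean x i \<mu> \<nu> \<le> (\<integral>p. (\<Sum>l\<in>UNIV. y $ l * trans_prob \<Gamma> l (i, p)) + c \<partial>(\<mu> \<Otimes>\<^sub>M \<nu>))"
    unfolding next_mean_def
  proof (rule integral_mono)
    fix p assume "p \<in> space (\<mu> \<Otimes>\<^sub>M \<nu>)"
    then have p: "(i, p) \<in> feasible \<Gamma>"
      by (auto simp: space_pair_measure borel_probsD(3)[OF \<mu>] borel_probsD(3)[OF \<nu>] feasible_iff)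
    have "(\<Sum>l\<in>UNIV. x $ l * trans_prob \<Gamma> l (i, p)) \<le> (\<Sum>l\<in>UNIV. (y $ l + c) * trans_prob \<Gamma> l (i, p))"
      by (intro sum_mono mult_right_mono le trans_prob_nonneg)
    also have "\<dots> = (\<Sum>l\<in>UNIV. y $ l * trans_prob \<Gamma> l (i, p)) + c * (\<Sum>l\<in>UNIV. trans_prob \<Gamma> l (i, p))"
      by (simp add: distrib_right sum.distrib sum_distrib_left)
    finally show "(\<Sum>l\<in>UNIV. x $ l * trans_prob \<Gamma> l (i, p)) \<le> (\<Sum>l\<in>UNIV. y $ l * trans_prob \<Gamma> l (i, p)) + c"
      by (simp add: sum_trans_prob[OF p])
  qed (intro Bochner_Integration.integrable_add integrable_next_mean \<mu> \<nu> integrable_const)+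
  also have "\<dots> = next_mean y i \<mu> \<nu> + c"
    unfolding next_mean_def using integrable_next_mean[OF \<mu> \<nu>]
    by (subst Bochner_Integration.integral_add) (auto simp: prob_space)
  finally show ?thesis .
qed

lemma next_mean_const:
  assumes "\<mu> \<in> max_mixed i" "\<nu> \<in> min_mixed i"
  shows "(\<And>l. x $ l \<le> c) \<Longrightarrow> next_mean x i \<mu> \<nu> \<le> c" "(\<And>l. c \<le> x $ l) \<Longrightarrow> c \<le> next_mean x i \<mu> \<nu>"
proof -
  have "next_mean 0 i \<mu> \<nu> = 0" by (simp add: next_mean_def)
  then show "(\<And>l. x $ l \<le> c) \<Longrightarrow> next_mean x i \<mu> \<nu> \<le> c" "(\<And>l. c \<le> x $ l) \<Longrightarrow> c \<le> next_mean x i \<mu> \<nu>"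
    using next_mean_mono[OF assms, of x 0 c] next_mean_mono[OF assms, of 0 x "- c"] by auto
qed

text \<open>A mixed action of Max concentrated on \<open>S\<close> certifies a lower bound.
  Restricting to \<open>S\<close> matters because the payoff may be unbounded below over all actions
  of Max.\<close>

lemma stage_value_ge:
  assumes \<mu>: "\<mu> \<in> max_mixed i" and S: "AE a in \<mu>. a \<in> S"
    and C: "0 \<le> C" "\<And>a b. a \<in> S \<Longrightarrow> b \<in> min_avail \<Gamma> i \<Longrightarrow> - C \<le> payoff \<Gamma> (i, a, b)"
    and d: "\<And>\<nu>. \<nu> \<in> min_mixed i \<Longrightarrow> d \<le> next_mean x i \<mu> \<nu>"
  shows "ereal (d - C) \<le> stage_value x i"
  unfolding stage_value_def
proof (rule SUP_upper2[OF \<mu>], rule INF_greatest)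
  fix \<nu> assume \<nu>: "\<nu> \<in> min_mixed i"
  have "ereal (- C) \<le> mixed_ext (payoff \<Gamma>) i \<mu> \<nu>"
    unfolding mixed_ext_def
  proof (rule quasi_integral_ge[OF borel_probsD(1)[OF \<mu>] C(1)])
    show "AE a in \<mu>. ereal (- C) \<le> quasi_integral \<nu> (\<lambda>b. ereal (payoff \<Gamma> (i, a, b)))"
      using S
    proof eventually_elim
      case (elim a)
      then show ?case
        using C(2) by (intro quasi_integral_ge[OF borel_probsD(1)[OF \<nu>] C(1)] AE_I2)
          (simp add: borel_probsD(3)[OF \<nu>])
    qed
  qed
  with d[OF \<nu>] have "ereal (- C) + ereal d \<le> mixed_ext (payoff \<Gamma>) i \<mu> \<nu> + ereal (next_mean x i \<mu> \<nu>)"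
    by (intro add_mono) auto
  then show "ereal (d - C) \<le> mixed_ext (payoff \<Gamma>) i \<mu> \<nu> + ereal (next_mean x i \<mu> \<nu>)" by simp
qed

text \<open>A single mixed action of Min bounds the infimum for every \<open>\<mu>\<close> at once,
  hence the supremum.\<close>

lemma stage_value_le:
  assumes \<nu>: "\<nu> \<in> min_mixed i" and S: "AE b in \<nu>. b \<in> S"
    and C: "0 \<le> C" "\<And>a b. a \<in> max_avail \<Gamma> i \<Longrightarrow> b \<in> S \<Longrightarrow> payoff \<Gamma> (i, a, b) \<le> C"
    and d: "\<And>\<mu>. \<mu> \<in> max_mixed i \<Longrightarrow> next_mean x i \<mu> \<nu> \<le> d"
  shows "stage_value x i \<le> ereal (d + C)"
  unfolding stage_value_def
proof (rule SUP_least, rule INF_lower2[OF \<nu>])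
  fix \<mu> assume \<mu>: "\<mu> \<in> max_mixed i"
  have "mixed_ext (payoff \<Gamma>) i \<mu> \<nu> \<le> ereal C"
    unfolding mixed_ext_def
  proof (rule quasi_integral_le[OF borel_probsD(1)[OF \<mu>] C(1)], rule AE_I2)
    fix a assume "a \<in> space \<mu>"
    then show "quasi_integral \<nu> (\<lambda>b. ereal (payoff \<Gamma> (i, a, b))) \<le> ereal C"
      using S C(2) by (intro quasi_integral_le[OF borel_probsD(1)[OF \<nu>] C(1)])
        (auto simp: borel_probsD(3)[OF \<mu>] elim!: eventually_mono)
  qed
  with d[OF \<mu>] have "mixed_ext (payoff \<Gamma>) i \<mu> \<nu> + ereal (next_mean x i \<mu> \<nu>) \<le> ereal C + ereal d"
    by (intro add_mono) auto
  then show "mixed_ext (payoff \<Gamma>) i \<mu> \<nu> + ereal (next_mean x i \<mu> \<nu>) \<le> ereal (d + C)"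
    by (simp add: add.commute)
qed

text \<open>For one \<open>a\<close>, lower semicontinuity in Min's action on a compact set gives a
  bound; finitely many bounds combine by a maximum.\<close>

lemma payoff_lower_bound:
  assumes "finite S" "S \<subseteq> max_avail \<Gamma> i"
  obtains C where "0 \<le> C" "\<And>a b. a \<in> S \<Longrightarrow> b \<in> min_avail \<Gamma> i \<Longrightarrow> - C \<le> payoff \<Gamma> (i, a, b)"
proof -
  have "\<exists>C\<ge>0. \<forall>a\<in>S. \<forall>b\<in>min_avail \<Gamma> i. - C \<le> payoff \<Gamma> (i, a, b)"
    using assms
  proof (induction S)
    case (insert a S)
    then obtain C where C: "0 \<le> C" "\<forall>a\<in>S. \<forall>b\<in>min_avail \<Gamma> i. - C \<le> payoff \<Gamma> (i, a, b)" by auto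
    obtain C' where "0 \<le> C'" "\<And>b. b \<in> min_avail \<Gamma> i \<Longrightarrow> - C' \<le> payoff \<Gamma> (i, a, b)"
      using lsc_on_compact_bounded_below[OF conjunct2[OF min_compact] payoff_lsc] insert.prems
      by (metis insert_subset)
    with C show ?case by (intro exI[of _ "max C C'"]) (auto simp: max_def; smt (verit))
  qed auto
  then show ?thesis using that by blast
qed

lemma payoff_upper_bound:
  assumes "finite S" "S \<subseteq> min_avail \<Gamma> i"
  obtains C where "0 \<le> C" "\<And>a b. a \<in> max_avail \<Gamma> i \<Longrightarrow> b \<in> S \<Longrightarrow> payoff \<Gamma> (i, a, b) \<le> C"
proof -
  have "\<exists>C\<ge>0. \<forall>b\<in>S. \<forall>a\<in>max_avail \<Gamma> i. payoff \<Gamma> (i, a, b) \<le> C"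
    using assms
  proof (induction S)
    case (insert b S)
    then obtain C where C: "0 \<le> C" "\<forall>b\<in>S. \<forall>a\<in>max_avail \<Gamma> i. payoff \<Gamma> (i, a, b) \<le> C" by auto
    obtain C' where "0 \<le> C'" "\<And>a. a \<in> max_avail \<Gamma> i \<Longrightarrow> payoff \<Gamma> (i, a, b) \<le> C'"
      using usc_on_compact_bounded_above[OF conjunct2[OF max_compact] payoff_usc] insert.prems
      by (metis insert_subset)
    with C show ?case by (intro exI[of _ "max C C'"]) (auto simp: le_max_iff_disj)
  qed auto
  then show ?thesis using that by blast
qed

text \<open>A pure action of Max bounds the value from below and one of Min from above, together
  with the extreme coordinates of \<open>x\<close>. Hence \<open>real_of_ereal\<close> in
  \<open>shapley\<close> acts on a finite value.\<close>

lemma stage_value_finite: "\<bar>stage_value x i\<bar> \<noteq> \<infinity>"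
proof -
  obtain a b where a: "a \<in> max_avail \<Gamma> i" and b: "b \<in> min_avail \<Gamma> i"
    using max_compact min_compact by blast
  obtain C where C: "0 \<le> C" "\<And>a' b. a' \<in> {a} \<Longrightarrow> b \<in> min_avail \<Gamma> i \<Longrightarrow> - C \<le> payoff \<Gamma> (i, a', b)"
    using payoff_lower_bound[of "{a}" i] a by auto
  obtain C' where C': "0 \<le> C'" "\<And>a b'. a \<in> max_avail \<Gamma> i \<Longrightarrow> b' \<in> {b} \<Longrightarrow> payoff \<Gamma> (i, a, b') \<le> C'"
    using payoff_upper_bound[of "{b}" i] b by auto
  have \<mu>: "uniform_on (max_avail \<Gamma> i) {a} \<in> max_mixed i"
    using a by (intro uniform_on_borel_probs) auto
  have \<nu>: "uniform_on (min_avail \<Gamma> i) {b} \<in> min_mixed i"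
    using b by (intro uniform_on_borel_probs) auto
  have x: "Min (range (($) x)) \<le> x $ l" "x $ l \<le> Max (range (($) x))" for l
    by auto
  have "ereal (Min (range (($) x)) - C) \<le> stage_value x i"
    using a by (intro stage_value_ge[OF \<mu> AE_uniform_on C] next_mean_const[OF \<mu>] x) auto
  moreover have "stage_value x i \<le> ereal (Max (range (($) x)) + C')"
    using b by (intro stage_value_le[OF \<nu> AE_uniform_on C'] next_mean_const[OF _ \<nu>] x) auto
  ultimately show ?thesis by auto
qed

lemma shapley_ge: "ereal c \<le> stage_value x i \<Longrightarrow> c \<le> shapley \<Gamma> x $ i"
  and shapley_le: "stage_value x i \<le> ereal c \<Longrightarrow> shapley \<Gamma> x $ i \<le> c"
  unfolding shapley_eq using stage_value_finite[of x i] by (cases "stage_value x i"; auto)+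

lemma stage_value_shift:
  assumes le: "\<And>l. x $ l \<le> y $ l + c"
  shows "stage_value x i \<le> stage_value y i + ereal c"
proof -
  let ?v = "\<lambda>x \<mu> \<nu>. mixed_ext (payoff \<Gamma>) i \<mu> \<nu> + ereal (next_mean x i \<mu> \<nu>)"
  have "(INF \<nu>\<in>min_mixed i. ?v x \<mu> \<nu>) \<le> stage_value y i + ereal c" if \<mu>: "\<mu> \<in> max_mixed i" for \<mu>
  proof -
    have "(INF \<nu>\<in>min_mixed i. ?v x \<mu> \<nu>) - ereal c \<le> (INF \<nu>\<in>min_mixed i. ?v y \<mu> \<nu>)"
    proof (rule INF_greatest)
      fix \<nu> assume \<nu>: "\<nu> \<in> min_mixed i"
      have "(INF \<nu>\<in>min_mixed i. ?v x \<mu> \<nu>) \<le> ?v x \<mu> \<nu>" using \<nu> by (rule INF_lower)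
      also have "\<dots> \<le> mixed_ext (payoff \<Gamma>) i \<mu> \<nu> + ereal (next_mean y i \<mu> \<nu> + c)"
        using next_mean_mono[OF \<mu> \<nu> le] by (intro add_left_mono) simp
      finally show "(INF \<nu>\<in>min_mixed i. ?v x \<mu> \<nu>) - ereal c \<le> ?v y \<mu> \<nu>"
        by (simp add: ereal_minus_le add.assoc)
    qed
    also have "\<dots> \<le> stage_value y i" unfolding stage_value_def using \<mu> by (rule SUP_upper)
    finally show ?thesis by (simp add: ereal_minus_le)
  qed
  then show ?thesis unfolding stage_value_def[of x] by (rule SUP_least)
qed

lemma topical_shapley: "topical (shapley \<Gamma>)"
  unfolding topical_def
proof (intro allI impI)
  fix x y :: "real ^ 'n" and c i assume "\<forall>l. x $ l \<le> y $ l + c"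
  then have "stage_value x i \<le> stage_value y i + ereal c" by (intro stage_value_shift) blast
  moreover have "stage_value y i = ereal (shapley \<Gamma> y $ i)"
    using stage_value_finite[of y i] by (simp add: shapley_eq ereal_real)
  ultimately show "shapley \<Gamma> x $ i \<le> shapley \<Gamma> y $ i + c" by (intro shapley_le) simp
qed

section \<open>Response of the operator to confinement and to escape\<close>

text \<open>Zero exit probability forces \<open>trans_prob\<close> to vanish outside
  \<open>D\<close>, so the mean only sees coordinates in \<open>D\<close>.\<close>

lemma confined_mean_bounds:
  assumes k: "k \<in> feasible \<Gamma>" and exit0: "exit_prob \<Gamma> D k = 0"
  shows "(\<And>l. l \<in> D \<Longrightarrow> m \<le> u $ l) \<Longrightarrow> m \<le> (\<Sum>l\<in>UNIV. u $ l * trans_prob \<Gamma> l k)"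
    and "(\<And>l. l \<in> D \<Longrightarrow> u $ l \<le> m) \<Longrightarrow> (\<Sum>l\<in>UNIV. u $ l * trans_prob \<Gamma> l k) \<le> m"
proof -
  have zero: "trans_prob \<Gamma> l k = 0" if "l \<notin> D" for l
    using exit0 that unfolding exit_prob_sum[OF k]
    by (subst (asm) sum_nonneg_eq_0_iff) (auto simp: trans_prob_nonneg)
  have m: "(\<Sum>l\<in>UNIV. m * trans_prob \<Gamma> l k) = m"
    using sum_trans_prob[OF k] by (simp add: sum_distrib_left[symmetric])
  show "m \<le> (\<Sum>l\<in>UNIV. u $ l * trans_prob \<Gamma> l k)" if "\<And>l. l \<in> D \<Longrightarrow> m \<le> u $ l"
  proof -
    have "m * trans_prob \<Gamma> l k \<le> u $ l * trans_prob \<Gamma> l k" for l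
      using that zero by (cases "l \<in> D") (auto intro: mult_right_mono trans_prob_nonneg)
    then have "(\<Sum>l\<in>UNIV. m * trans_prob \<Gamma> l k) \<le> (\<Sum>l\<in>UNIV. u $ l * trans_prob \<Gamma> l k)"
      by (rule sum_mono)
    then show ?thesis unfolding m .
  qed
  show "(\<Sum>l\<in>UNIV. u $ l * trans_prob \<Gamma> l k) \<le> m" if "\<And>l. l \<in> D \<Longrightarrow> u $ l \<le> m"
  proof -
    have "u $ l * trans_prob \<Gamma> l k \<le> m * trans_prob \<Gamma> l k" for l
      using that zero by (cases "l \<in> D") (auto intro: mult_right_mono trans_prob_nonneg)
    then have "(\<Sum>l\<in>UNIV. u $ l * trans_prob \<Gamma> l k) \<le> (\<Sum>l\<in>UNIV. m * trans_prob \<Gamma> l k)"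
      by (rule sum_mono)
    then show ?thesis unfolding m .
  qed
qed

text \<open>When Max plays \<open>a\<close>, the continuation value is an average over
  \<open>D\<close> and the payoff is at least \<open>- C\<close>. This \<open>C\<close> does not
  depend on \<open>u\<close> or \<open>m\<close>, so a perturbation can be fixed before a solution
  of the ergodic equation is given.\<close>

lemma shapley_ge_if_confined:
  assumes a: "a \<in> max_avail \<Gamma> i" and stay: "\<And>b. b \<in> min_avail \<Gamma> i \<Longrightarrow> exit_prob \<Gamma> D (i, a, b) = 0"
  shows "\<exists>C. \<forall>u m. (\<forall>l\<in>D. m \<le> u $ l) \<longrightarrow> m - C \<le> shapley \<Gamma> u $ i"
proof -
  obtain C where C: "0 \<le> C" "\<And>a' b. a' \<in> {a} \<Longrightarrow> b \<in> min_avail \<Gamma> i \<Longrightarrow> - C \<le> payoff \<Gamma> (i, a', b)"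
    using payoff_lower_bound[of "{a}" i] a by auto
  let ?\<mu> = "uniform_on (max_avail \<Gamma> i) {a}"
  have \<mu>: "?\<mu> \<in> max_mixed i" using a by (intro uniform_on_borel_probs) auto
  have ae: "AE x in ?\<mu>. x \<in> {a}" using a by (intro AE_uniform_on) auto
  have "m - C \<le> shapley \<Gamma> u $ i" if u: "\<forall>l\<in>D. m \<le> u $ l" for u m
  proof (rule shapley_ge, rule stage_value_ge[OF \<mu> ae C])
    fix \<nu> assume \<nu>: "\<nu> \<in> min_mixed i"
    interpret prob_space "?\<mu> \<Otimes>\<^sub>M \<nu>" using \<mu> \<nu> by (rule mixed_prob_space)
    have "AE p in ?\<mu> \<Otimes>\<^sub>M \<nu>. fst p \<in> {a}"
      using a by (intro AE_pair_fst borel_probsD(1)[OF \<mu>] borel_probsD(1)[OF \<nu>] ae)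
        (auto simp: borel_probsD(2)[OF \<mu>] intro!: sets_restrict_borel_finite)
    then have "AE p in ?\<mu> \<Otimes>\<^sub>M \<nu>. m \<le> (\<Sum>l\<in>UNIV. u $ l * trans_prob \<Gamma> l (i, p))"
    proof (rule AE_mp[OF _ AE_I2], intro impI)
      fix p assume "p \<in> space (?\<mu> \<Otimes>\<^sub>M \<nu>)" "fst p \<in> {a}"
      then obtain b where "p = (a, b)" "b \<in> min_avail \<Gamma> i"
        by (cases p) (auto simp: space_pair_measure borel_probsD(3)[OF \<nu>])
      then show "m \<le> (\<Sum>l\<in>UNIV. u $ l * trans_prob \<Gamma> l (i, p))"
        using a stay u by (intro confined_mean_bounds(1)[of _ D]) (auto simp: feasible_iff)
    qed
    then show "m \<le> next_mean u i ?\<mu> \<nu>"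
      unfolding next_mean_def by (intro integral_ge_const integrable_next_mean[OF \<mu> \<nu>])
  qed
  then show ?thesis by blast
qed

text \<open>Dual bound from Min's confining action \<open>b\<close>, again with a constant chosen
  before \<open>u\<close> and \<open>m\<close>.\<close>

lemma shapley_le_if_confined:
  assumes b: "b \<in> min_avail \<Gamma> i" and stay: "\<And>a. a \<in> max_avail \<Gamma> i \<Longrightarrow> exit_prob \<Gamma> D (i, a, b) = 0"
  shows "\<exists>C. \<forall>u m. (\<forall>l\<in>D. u $ l \<le> m) \<longrightarrow> shapley \<Gamma> u $ i \<le> m + C"
proof -
  obtain C where C: "0 \<le> C" "\<And>a b'. a \<in> max_avail \<Gamma> i \<Longrightarrow> b' \<in> {b} \<Longrightarrow> payoff \<Gamma> (i, a, b') \<le> C"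
    using payoff_upper_bound[of "{b}" i] b by auto
  let ?\<nu> = "uniform_on (min_avail \<Gamma> i) {b}"
  have \<nu>: "?\<nu> \<in> min_mixed i" using b by (intro uniform_on_borel_probs) auto
  have ae: "AE x in ?\<nu>. x \<in> {b}" using b by (intro AE_uniform_on) auto
  have "shapley \<Gamma> u $ i \<le> m + C" if u: "\<forall>l\<in>D. u $ l \<le> m" for u m
  proof (rule shapley_le, rule stage_value_le[OF \<nu> ae C])
    fix \<mu> assume \<mu>: "\<mu> \<in> max_mixed i"
    interpret prob_space "\<mu> \<Otimes>\<^sub>M ?\<nu>" using \<mu> \<nu> by (rule mixed_prob_space)
    have "AE p in \<mu> \<Otimes>\<^sub>M ?\<nu>. snd p \<in> {b}"
      using b by (intro AE_pair_snd borel_probsD(1)[OF \<mu>] borel_probsD(1)[OF \<nu>] ae)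
        (auto simp: borel_probsD(2)[OF \<nu>] intro!: sets_restrict_borel_finite)
    then have "AE p in \<mu> \<Otimes>\<^sub>M ?\<nu>. (\<Sum>l\<in>UNIV. u $ l * trans_prob \<Gamma> l (i, p)) \<le> m"
    proof (rule AE_mp[OF _ AE_I2], intro impI)
      fix p assume "p \<in> space (\<mu> \<Otimes>\<^sub>M ?\<nu>)" "snd p \<in> {b}"
      then obtain a where "p = (a, b)" "a \<in> max_avail \<Gamma> i"
        by (cases p) (auto simp: space_pair_measure borel_probsD(3)[OF \<mu>])
      then show "(\<Sum>l\<in>UNIV. u $ l * trans_prob \<Gamma> l (i, p)) \<le> m"
        using b stay u by (intro confined_mean_bounds(2)[of _ D]) (auto simp: feasible_iff)
    qed
    then show "next_mean u i \<mu> ?\<nu> \<le> m"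
      unfolding next_mean_def by (intro integral_le_const integrable_next_mean[OF \<mu> \<nu>])
  qed
  then show ?thesis by blast
qed

lemma next_mean_level_vec:
  assumes \<mu>: "\<mu> \<in> max_mixed i" and \<nu>: "\<nu> \<in> min_mixed i"
  shows "next_mean (level_vec D s) i \<mu> \<nu> = s * (\<integral>p. exit_prob \<Gamma> D (i, p) \<partial>(\<mu> \<Otimes>\<^sub>M \<nu>))"
proof -
  have "(\<Sum>l\<in>UNIV. level_vec D s $ l * trans_prob \<Gamma> l (i, p)) = s * exit_prob \<Gamma> D (i, p)"
    if "p \<in> space (\<mu> \<Otimes>\<^sub>M \<nu>)" for p
  proof -
    have p: "(i, p) \<in> feasible \<Gamma>"
      using that by (auto simp: space_pair_measure borel_probsD(3)[OF \<mu>] borel_probsD(3)[OF \<nu>] feasible_iff)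
    have "(\<Sum>l\<in>UNIV. level_vec D s $ l * trans_prob \<Gamma> l (i, p)) = (\<Sum>l\<in>- D. s * trans_prob \<Gamma> l (i, p))"
      by (rule sum.mono_neutral_cong_right) (auto simp: level_vec_def)
    then show ?thesis by (simp add: exit_prob_sum[OF p] sum_distrib_left)
  qed
  then have "next_mean (level_vec D s) i \<mu> \<nu> = (\<integral>p. s * exit_prob \<Gamma> D (i, p) \<partial>(\<mu> \<Otimes>\<^sub>M \<nu>))"
    unfolding next_mean_def by (intro Bochner_Integration.integral_cong) auto
  then show ?thesis by simp
qed

lemma exit_prob_measurable_sections:
  shows "a \<in> max_avail \<Gamma> i \<Longrightarrow>
      (\<lambda>b. exit_prob \<Gamma> D (i, a, b)) \<in> borel_measurable (restrict_space borel (min_avail \<Gamma> i))"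
    and "b \<in> min_avail \<Gamma> i \<Longrightarrow>
      (\<lambda>a. exit_prob \<Gamma> D (i, a, b)) \<in> borel_measurable (restrict_space borel (max_avail \<Gamma> i))"
proof -
  note m = measurable_compose[OF measurable_feasible_embed measurable_exit_prob[OF game, of D], of i]
  show "(\<lambda>b. exit_prob \<Gamma> D (i, a, b)) \<in> borel_measurable (restrict_space borel (min_avail \<Gamma> i))"
    if "a \<in> max_avail \<Gamma> i"
    using that by (intro measurable_compose[OF measurable_Pair1' m]) (simp add: space_restrict_space)
  show "(\<lambda>a. exit_prob \<Gamma> D (i, a, b)) \<in> borel_measurable (restrict_space borel (max_avail \<Gamma> i))"
    if "b \<in> min_avail \<Gamma> i"
    using that by (intro measurable_compose[OF measurable_Pair2' m]) (simp add: space_restrict_space)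
qed

text \<open>Every action of Max is met by an action of Min with positive exit probability, and
  compactness leaves a finite set \<open>S\<close> of these with a common bound
  \<open>\<delta>\<close>. The uniform mixture on \<open>S\<close> leaves \<open>D\<close> with
  probability at least \<open>\<delta> / card S\<close> whatever Max plays.\<close>

lemma max_escape:
  assumes "\<not> (\<exists>a\<in>max_avail \<Gamma> i. \<forall>b\<in>min_avail \<Gamma> i. exit_prob \<Gamma> D (i, a, b) = 0)"
  shows "\<exists>s. shapley \<Gamma> (level_vec D (- s)) $ i < c"
proof -
  have pos: "\<exists>b\<in>min_avail \<Gamma> i. 0 < exit_prob \<Gamma> D (i, a, b)" if "a \<in> max_avail \<Gamma> i" for a
    using assms that exit_prob_nonneg[of \<Gamma> D] by (metis order_less_le)
  obtain S \<delta> where S: "finite S" "S \<noteq> {}" "S \<subseteq> min_avail \<Gamma> i" and "0 < \<delta>"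
    and \<delta>: "\<And>a. a \<in> max_avail \<Gamma> i \<Longrightarrow> \<exists>b\<in>S. \<delta> \<le> exit_prob \<Gamma> D (i, a, b)"
    using max_compact[of i]
    by (auto intro: lsc_on_finite_cover[of "max_avail \<Gamma> i" "min_avail \<Gamma> i" "\<lambda>a b. exit_prob \<Gamma> D (i, a, b)",
          OF _ _ exit_prob_lsc_max pos])
  define \<epsilon> where "\<epsilon> = \<delta> / card S"
  have \<epsilon>: "0 < \<epsilon>" using \<open>0 < \<delta>\<close> S by (simp add: \<epsilon>_def card_gt_0_iff)
  obtain C where C: "0 \<le> C" "\<And>a b. a \<in> max_avail \<Gamma> i \<Longrightarrow> b \<in> S \<Longrightarrow> payoff \<Gamma> (i, a, b) \<le> C"
    using payoff_upper_bound[OF S(1,3)] by blast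
  let ?\<nu> = "uniform_on (min_avail \<Gamma> i) S"
  have \<nu>: "?\<nu> \<in> min_mixed i" using S by (rule uniform_on_borel_probs)
  \<comment> \<open>Makes \<open>- s * \<epsilon> + C\<close> at most \<open>c - 1\<close>; the
    maximum with 0 keeps \<open>s\<close> nonnegative, so that multiplication by \<open>- s\<close>
    reverses the exit bound.\<close>
  define s where "s = max 0 ((C - c + 1) / \<epsilon>)"
  have s: "0 \<le> s" "C - c + 1 \<le> s * \<epsilon>"
    using \<epsilon> by (auto simp: s_def pos_divide_le_eq[symmetric])
  have "stage_value (level_vec D (- s)) i \<le> ereal (- s * \<epsilon> + C)"
  proof (rule stage_value_le[OF \<nu> AE_uniform_on[OF S] C])
    fix \<mu> assume \<mu>: "\<mu> \<in> max_mixed i"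
    interpret \<mu>: prob_space \<mu> by (rule borel_probsD(1)[OF \<mu>])
    interpret \<nu>: prob_space ?\<nu> by (rule borel_probsD(1)[OF \<nu>])
    interpret pair_sigma_finite \<mu> ?\<nu> ..
    have int: "integrable (\<mu> \<Otimes>\<^sub>M ?\<nu>) (\<lambda>(a, b). exit_prob \<Gamma> D (i, a, b))"
      using integrable_exit_prob[OF \<mu> \<nu>, of D] by (simp add: case_prod_beta')
    have "\<epsilon> \<le> (\<integral>a. \<integral>b. exit_prob \<Gamma> D (i, a, b) \<partial>?\<nu> \<partial>\<mu>)"
    proof (intro \<mu>.integral_ge_const integrable_fst[OF int] AE_I2)
      fix a assume "a \<in> space \<mu>"
      then have a: "a \<in> max_avail \<Gamma> i" by (simp add: borel_probsD(3)[OF \<mu>])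
      show "\<epsilon> \<le> (\<integral>b. exit_prob \<Gamma> D (i, a, b) \<partial>?\<nu>)"
        unfolding \<epsilon>_def
        by (rule integral_uniform_on_ge[OF S exit_prob_measurable_sections(1)[OF a] exit_prob_nonneg \<delta>[OF a]])
    qed
    also have "\<dots> = (\<integral>p. exit_prob \<Gamma> D (i, p) \<partial>(\<mu> \<Otimes>\<^sub>M ?\<nu>))"
      using integral_fst[OF int] by (simp add: case_prod_beta')
    finally show "next_mean (level_vec D (- s)) i \<mu> ?\<nu> \<le> - s * \<epsilon>"
      unfolding next_mean_level_vec[OF \<mu> \<nu>] using s(1) by (simp add: mult_left_mono)
  qed
  then have "shapley \<Gamma> (level_vec D (- s)) $ i \<le> - s * \<epsilon> + C" by (rule shapley_le)
  then show ?thesis using s(2) by (intro exI[of _ s]) simp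
qed

text \<open>Mirror image of \<open>max_escape\<close>, with a finite mixture of Max and a payoff
  bounded below on its support.\<close>

lemma min_escape:
  assumes "\<not> (\<exists>b\<in>min_avail \<Gamma> i. \<forall>a\<in>max_avail \<Gamma> i. exit_prob \<Gamma> D (i, a, b) = 0)"
  shows "\<exists>s. c < shapley \<Gamma> (level_vec D s) $ i"
proof -
  have pos: "\<exists>a\<in>max_avail \<Gamma> i. 0 < exit_prob \<Gamma> D (i, a, b)" if "b \<in> min_avail \<Gamma> i" for b
    using assms that exit_prob_nonneg[of \<Gamma> D] by (metis order_less_le)
  obtain S \<delta> where S: "finite S" "S \<noteq> {}" "S \<subseteq> max_avail \<Gamma> i" and "0 < \<delta>"
    and \<delta>: "\<And>b. b \<in> min_avail \<Gamma> i \<Longrightarrow> \<exists>a\<in>S. \<delta> \<le> exit_prob \<Gamma> D (i, a, b)"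
    using min_compact[of i]
    by (auto intro: lsc_on_finite_cover[of "min_avail \<Gamma> i" "max_avail \<Gamma> i" "\<lambda>b a. exit_prob \<Gamma> D (i, a, b)",
          OF _ _ exit_prob_lsc_min pos])
  define \<epsilon> where "\<epsilon> = \<delta> / card S"
  have \<epsilon>: "0 < \<epsilon>" using \<open>0 < \<delta>\<close> S by (simp add: \<epsilon>_def card_gt_0_iff)
  obtain C where C: "0 \<le> C" "\<And>a b. a \<in> S \<Longrightarrow> b \<in> min_avail \<Gamma> i \<Longrightarrow> - C \<le> payoff \<Gamma> (i, a, b)"
    using payoff_lower_bound[OF S(1,3)] by blast
  let ?\<mu> = "uniform_on (max_avail \<Gamma> i) S"
  have \<mu>: "?\<mu> \<in> max_mixed i" using S by (rule uniform_on_borel_probs)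
  define s where "s = max 0 ((C + c + 1) / \<epsilon>)"
  have s: "0 \<le> s" "C + c + 1 \<le> s * \<epsilon>"
    using \<epsilon> by (auto simp: s_def pos_divide_le_eq[symmetric])
  have "ereal (s * \<epsilon> - C) \<le> stage_value (level_vec D s) i"
  proof (rule stage_value_ge[OF \<mu> AE_uniform_on[OF S] C])
    fix \<nu> assume \<nu>: "\<nu> \<in> min_mixed i"
    interpret \<mu>: prob_space ?\<mu> by (rule borel_probsD(1)[OF \<mu>])
    interpret \<nu>: prob_space \<nu> by (rule borel_probsD(1)[OF \<nu>])
    interpret pair_sigma_finite ?\<mu> \<nu> ..
    have int: "integrable (?\<mu> \<Otimes>\<^sub>M \<nu>) (\<lambda>(a, b). exit_prob \<Gamma> D (i, a, b))"
      using integrable_exit_prob[OF \<mu> \<nu>, of D] by (simp add: case_prod_beta')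
    \<comment> \<open>Max's mixture has to be the inner integral here, so the order of integration
      is reversed.\<close>
    have "\<epsilon> \<le> (\<integral>b. \<integral>a. exit_prob \<Gamma> D (i, a, b) \<partial>?\<mu> \<partial>\<nu>)"
    proof (intro \<nu>.integral_ge_const integrable_snd[OF int] AE_I2)
      fix b assume "b \<in> space \<nu>"
      then have b: "b \<in> min_avail \<Gamma> i" by (simp add: borel_probsD(3)[OF \<nu>])
      show "\<epsilon> \<le> (\<integral>a. exit_prob \<Gamma> D (i, a, b) \<partial>?\<mu>)"
        unfolding \<epsilon>_def
        by (rule integral_uniform_on_ge[OF S exit_prob_measurable_sections(2)[OF b] exit_prob_nonneg \<delta>[OF b]])
    qed
    also have "\<dots> = (\<integral>p. exit_prob \<Gamma> D (i, p) \<partial>(?\<mu> \<Otimes>\<^sub>M \<nu>))"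
      using integral_snd[OF int] by (simp add: case_prod_beta')
    finally show "s * \<epsilon> \<le> next_mean (level_vec D s) i ?\<mu> \<nu>"
      unfolding next_mean_level_vec[OF \<mu> \<nu>] using s(1) by (simp add: mult_left_mono)
  qed
  then have "s * \<epsilon> - C \<le> shapley \<Gamma> (level_vec D s) $ i" by (rule shapley_ge)
  then show ?thesis using s(2) by (intro exI[of _ s]) simp
qed

section \<open>Ergodicity and disjoint dominions\<close>

text \<open>Adding \<open>g\<close> keeps the map topical and shifts each coordinate by a constant,
  so the escape estimates apply with threshold \<open>c - g $ i\<close>.\<close>

lemma ergodic_if_no_disjoint_dominions:
  assumes "\<not> (\<exists>D D'. max_dominion \<Gamma> D \<and> min_dominion \<Gamma> D' \<and> D \<inter> D' = {})"
  shows "ergodic \<Gamma>"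
  unfolding ergodic_def
proof
  fix g
  show "ergodic_eq_solvable (\<lambda>x. g + shapley \<Gamma> x)"
  proof (rule ergodic_eq_solvable_if_no_disjoint[OF topical_shift[OF topical_shapley]])
    fix D :: "'n set" assume "D \<noteq> {}" "\<not> max_dominion \<Gamma> D"
    then obtain i where "i \<in> D"
      "\<not> (\<exists>a\<in>max_avail \<Gamma> i. \<forall>b\<in>min_avail \<Gamma> i. exit_prob \<Gamma> D (i, a, b) = 0)"
      unfolding max_dominion_iff by blast
    then have "\<exists>s. (g + shapley \<Gamma> (level_vec D (- s))) $ i < c" for c
      using max_escape[of i D "c - g $ i"] by (auto simp: less_diff_eq add.commute)
    then show "\<exists>i\<in>D. \<forall>c. \<exists>s. (g + shapley \<Gamma> (level_vec D (- s))) $ i < c" using \<open>i \<in> D\<close> by blast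
  next
    fix D :: "'n set" assume "D \<noteq> {}" "\<not> min_dominion \<Gamma> D"
    then obtain i where "i \<in> D"
      "\<not> (\<exists>b\<in>min_avail \<Gamma> i. \<forall>a\<in>max_avail \<Gamma> i. exit_prob \<Gamma> D (i, a, b) = 0)"
      unfolding min_dominion_iff by blast
    then have "\<exists>s. c < (g + shapley \<Gamma> (level_vec D s)) $ i" for c
      using min_escape[of i D "c - g $ i"] by (auto simp: diff_less_eq add.commute)
    then show "\<exists>i\<in>D. \<forall>c. \<exists>s. c < (g + shapley \<Gamma> (level_vec D s)) $ i" using \<open>i \<in> D\<close> by blast
  qed (use assms in blast)
qed

lemma ergodic_no_disjoint_dominions:
  assumes "ergodic \<Gamma>" "max_dominion \<Gamma> D" "min_dominion \<Gamma> D'"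
  shows "D \<inter> D' \<noteq> {}"
proof
  assume disj: "D \<inter> D' = {}"
  have "\<forall>i. \<exists>C. i \<in> D \<longrightarrow> (\<forall>u m. (\<forall>l\<in>D. m \<le> u $ l) \<longrightarrow> m - C \<le> shapley \<Gamma> u $ i)"
    using assms(2) shapley_ge_if_confined[of _ _ D] unfolding max_dominion_iff by metis
  then obtain C where C: "\<And>i u m. i \<in> D \<Longrightarrow> \<forall>l\<in>D. m \<le> u $ l \<Longrightarrow> m - C i \<le> shapley \<Gamma> u $ i" by metis
  have "\<forall>i. \<exists>C. i \<in> D' \<longrightarrow> (\<forall>u m. (\<forall>l\<in>D'. u $ l \<le> m) \<longrightarrow> shapley \<Gamma> u $ i \<le> m + C)"
    using assms(3) shapley_le_if_confined[of _ _ D'] unfolding min_dominion_iff by metis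
  then obtain C' where C': "\<And>i u m. i \<in> D' \<Longrightarrow> \<forall>l\<in>D'. u $ l \<le> m \<Longrightarrow> shapley \<Gamma> u $ i \<le> m + C' i" by metis
  \<comment> \<open>The offsets exceed the confinement constants by 1, which pushes the constant
    \<open>c\<close> of the ergodic equation to at least 1 through \<open>D\<close> and to at most
    -1 through \<open>D'\<close>.\<close>
  define g :: "real ^ 'n" where "g = (\<chi> l. if l \<in> D then C l + 1 else - C' l - 1)"
  obtain c u where eq: "g + shapley \<Gamma> u = c *\<^sub>R (\<chi> i. 1) + u"
    using assms(1) unfolding ergodic_def ergodic_eq_solvable_def by blast
  have eq: "g $ i + shapley \<Gamma> u $ i = c + u $ i" for i
    using arg_cong[OF eq, of "\<lambda>v. v $ i"] by simp
  have ne: "D \<noteq> {}" "D' \<noteq> {}" using assms(2,3) by (auto simp: max_dominion_def min_dominion_def)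
  \<comment> \<open>At a minimiser of \<open>u\<close> over \<open>D\<close> the confinement bound
    with \<open>m = u $ i\<close> lets \<open>u $ i\<close> cancel in the equation; a maximiser over
    \<open>D'\<close> does the same for Min.\<close>
  obtain i where i: "i \<in> D" "\<forall>l\<in>D. u $ i \<le> u $ l"
    using arg_min_if_finite[of D "($) u"] ne(1) by (metis finite not_less)
  obtain j where j: "j \<in> D'" "\<forall>l\<in>D'. u $ l \<le> u $ j"
    using arg_min_if_finite[of D' "\<lambda>l. - u $ l"] ne(2) by (metis finite not_less neg_less_iff_less)
  have "1 \<le> c" using C[OF i] eq[of i] i(1) by (simp add: g_def)
  moreover have "j \<notin> D" using j(1) disj by blast
  then have "c \<le> - 1" using C'[OF j] eq[of j] by (simp add: g_def)
  ultimately show False by simp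
qed

end

theorem theorem2p11:
  fixes \<Gamma> :: "('n::finite, 'a::polish_space, 'b::polish_space) stochastic_game"
  assumes game: "is_stochastic_game \<Gamma>"
    and max_compact: "\<And>i. max_avail \<Gamma> i \<noteq> {} \<and> compact (max_avail \<Gamma> i)"
    and min_compact: "\<And>i. min_avail \<Gamma> i \<noteq> {} \<and> compact (min_avail \<Gamma> i)"
    and payoff_bounded: "\<And>i.
      bdd_below ((\<lambda>(a, b). payoff \<Gamma> (i, a, b)) ` (max_avail \<Gamma> i \<times> min_avail \<Gamma> i)) \<or>
      bdd_above ((\<lambda>(a, b). payoff \<Gamma> (i, a, b)) ` (max_avail \<Gamma> i \<times> min_avail \<Gamma> i))"
    and payoff_usc: "\<And>i b. b \<in> min_avail \<Gamma> i \<Longrightarrow>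
      usc_on (max_avail \<Gamma> i) (\<lambda>a. payoff \<Gamma> (i, a, b))"
    and trans_usc: "\<And>i b j. b \<in> min_avail \<Gamma> i \<Longrightarrow>
      usc_on (max_avail \<Gamma> i) (\<lambda>a. trans_prob \<Gamma> j (i, a, b))"
    and payoff_lsc: "\<And>i a. a \<in> max_avail \<Gamma> i \<Longrightarrow>
      lsc_on (min_avail \<Gamma> i) (\<lambda>b. payoff \<Gamma> (i, a, b))"
    and trans_lsc: "\<And>i a j. a \<in> max_avail \<Gamma> i \<Longrightarrow>
      lsc_on (min_avail \<Gamma> i) (\<lambda>b. trans_prob \<Gamma> j (i, a, b))"
  shows "ergodic \<Gamma> \<longleftrightarrow>
    \<not> (\<exists>D D'. max_dominion \<Gamma> D \<and> min_dominion \<Gamma> D' \<and> D \<inter> D' = {})"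
proof -
  interpret compact_game \<Gamma>
    by unfold_locales (fact game max_compact min_compact payoff_usc trans_usc payoff_lsc trans_lsc)+
  show ?thesis
    using ergodic_if_no_disjoint_dominions ergodic_no_disjoint_dominions by blast
qed

end
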